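(* Suppose the raw-data network and the processed-data network are non-overlapping, and consider a query stream of rate $\lambda$ with sources $s_1,s_2$ and destination $d$, computed at a single node $n$. Then the system is stable under policy $\pi_1$ for every query rate $\lambda<\lambda^*$.
   Context: Network: $\mathcal{G}=(\mathcal{V},\mathcal{E})$ is a finite graph with undirected edges; the edge between $m$ and $k$ has a fixed integer capacity $R_{mk}=R_{km}$ (packets per slot), shared by the two directions. $s_1,s_2\in\mathcal{V}$ are the sources, $d\in\mathcal{V}$ the destination, $n\in\mathcal{V}$ the computation node, which can process at most $C_n$ (integer) pairs per slot. Non-overlapping means: $\mathcal{G}$ is the union of two subgraphs $\mathcal{G}_1$ (containing $s_1,s_2,n$) and $\mathcal{G}_2$ (containing $n,d$) having no common node except $n$; raw packets are routed in $\mathcal{G}_1$ and processed packets in $\mathcal{G}_2$ (the case $n=d$ is allowed). Queries: time is slotted; $A(t)$ queries arrive in slot $t$, where $A(t)$ is i.i.d. over time with values in the nonnegative integers, $\mathbb{E}[A(t)]=\lambda$, $\mathbb{E}[A(t)^2]<\infty$. Each query generates one raw packet at $s_1$ and one at $s_2$, both carrying the same tag (distinct queries have distinct tags). The two raw packets of a query must both be brought to $n$ and combined there into one processed packet, which must be delivered to $d$. Queues (lengths at slot $t$): $Q_k^{(i,n)}(t)$, $i=1,2$, counts raw packets from $s_i$ waiting at node $k$ on their way to $n$ (with $Q_n^{(i,n)}(t)=0$); $X_n^{(i)}(t)$, $i=1,2$, counts raw packets from $s_i$ that have reached $n$ and wait to be combined; $Q_k^{(0,n)}(t)$ counts processed packets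 waiting at $k$ on their way to $d$ (with $Q_d^{(0,n)}(t)=0$). New raw packets join $Q_{s_i}^{(i,n)}$ (or $X_n^{(i)}$ if $s_i=n$); processed packets created at $n$ join $Q_n^{(0,n)}$ (or leave if $n=d$). $P_n(t)$ is the number of tags for which both raw packets are present and waiting at $n$. Backpressure (BP) routing: in each slot and for each link $(m,k)$, choose the class $c^*_{mk}(t)$ maximizing $|Q_m^{(c)}(t)-Q_k^{(c)}(t)|$ over the classes $c$ carried on the link, and set $U_{mk}^{(c)}(t)=R_{mk}$ if $c=c^*_{mk}(t)$ and $Q_m^{(c)}(t)>Q_k^{(c)}(t)$, and $U_{mk}^{(c)}(t)=0$ otherwise; any $U_{mk}^{(c)}(t)$ packets of class $c$ are then moved from $m$ to $k$ (if more service is allocated than packets available, only existing packets are moved). Policy $\pi_1$: route all packets by BP; at node $n$ in slot $t$ combine $\min\{P_n(t),C_n\}$ pairs of raw packets with equal tags. Stability: all queues are strongly stable, i.e. $\limsup_{T\to\infty}\frac1T\sum_{t=1}^T\mathbb{E}[Q_k^{(i,n)}(t)]<\infty$ for all nodes $k$ and $i\in\{0,1,2\}$, and $\limsup_{T\to\infty}\frac1T\sum_{t=1}^T\mathbb{E}[X_n^{(i)}(t)]<\infty$ for $i\in\{1,2\}$. Flow region: for a finite set $\mathcal{C}$ of commodities (source–destination pairs), $\Lambda_{\mathcal{G}}(\mathcal{C})$ is the set of rate vectors $(\lambda^{(c)})_{c\in\mathcal{C}}$ for which there exist flows $f_{mk}^{(c)}\ge 0$ (for each edge and each of its two directions) such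 that for every $c$ and node $m$, $\sum_k f_{mk}^{(c)}-\sum_k f_{km}^{(c)}$ equals $\lambda^{(c)}$ if $m$ is the source of $c$, $-\lambda^{(c)}$ if $m$ is the destination of $c$, and $0$ otherwise; $f_{mk}^{(c)}=0$ whenever $m$ is the destination of $c$; and $\sum_{c}\big(f_{mk}^{(c)}+f_{km}^{(c)}\big)\le R_{mk}$ for each edge. A commodity whose source equals its destination requires no flow. $\lambda^*=\sup\{\lambda\ge0:\ (\lambda,\lambda,\lambda)\in\Lambda_{\mathcal{G}}(\mathcal{C}_3),\ \lambda\le C_n\}$, where $\mathcal{C}_3=\{(s_1,n),(s_2,n),(n,d)\}$. *)

theory Defs
  imports "HOL-Probability.Probability"
begin

subsection \<open>Network\<close>

text \<open>Class \<open>Raw1\<close>, \<open>Raw2\<close>, \<open>Processed\<close> is class 1, 2, 0 respectively. The capacity is a function of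
  the undirected edge \<open>{m, k}\<close>, so it is symmetric and shared by the two directions.\<close>

datatype data_class = Raw1 | Raw2 | Processed

record 'v network =
  nodes :: "'v set"
  edges :: "'v set set"
  cap :: "'v set \<Rightarrow> nat"
  src1 :: 'v
  src2 :: 'v
  comp_node :: 'v
  dest :: 'v
  comp_cap :: nat

definition wf_network :: "'v network \<Rightarrow> bool" where
  "wf_network N \<longleftrightarrow> finite (nodes N) \<and>
     (\<forall>e\<in>edges N. \<exists>m\<in>nodes N. \<exists>k\<in>nodes N. m \<noteq> k \<and> e = {m, k}) \<and>
     {src1 N, src2 N, comp_node N, dest N} \<subseteq> nodes N"

fun source :: "'v network \<Rightarrow> data_class \<Rightarrow> 'v" where
  "source N Raw1 = src1 N"
| "source N Raw2 = src2 N"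
| "source N Processed = comp_node N"

fun sink :: "'v network \<Rightarrow> data_class \<Rightarrow> 'v" where
  "sink N Raw1 = comp_node N"
| "sink N Raw2 = comp_node N"
| "sink N Processed = dest N"

definition non_overlapping ::
  "'v network \<Rightarrow> 'v set \<Rightarrow> 'v set set \<Rightarrow> 'v set \<Rightarrow> 'v set set \<Rightarrow> bool" where
  "non_overlapping N V1 E1 V2 E2 \<longleftrightarrow>
     nodes N = V1 \<union> V2 \<and> edges N = E1 \<union> E2 \<and>
     (\<forall>e\<in>E1. e \<subseteq> V1) \<and> (\<forall>e\<in>E2. e \<subseteq> V2) \<and>
     V1 \<inter> V2 = {comp_node N} \<and> src1 N \<in> V1 \<and> src2 N \<in> V1 \<and> dest N \<in> V2"

definition carried :: "'v set set \<Rightarrow> 'v set set \<Rightarrow> 'v set \<Rightarrow> data_class set" where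
  "carried E1 E2 e =
     (if e \<in> E1 then {Raw1, Raw2} else {}) \<union> (if e \<in> E2 then {Processed} else {})"

subsection \<open>Flow region\<close>

text \<open>Commodities are indexed by \<open>C\<close>, with end points \<open>src\<close> and \<open>dst\<close>, rather than identified with
  the pairs \<open>(src c, dst c)\<close>: two commodities with the same end points (two raw streams
  generated at the same node) stay distinct and each needs its own flow.\<close>

definition flow_region ::
  "'v network \<Rightarrow> 'c set \<Rightarrow> ('c \<Rightarrow> 'v) \<Rightarrow> ('c \<Rightarrow> 'v) \<Rightarrow> ('c \<Rightarrow> real) set" where
  "flow_region N C src dst = {rate. \<exists>f :: 'c \<Rightarrow> 'v \<Rightarrow> 'v \<Rightarrow> real.
     (\<forall>c\<in>C. \<forall>m k. f c m k \<ge> 0 \<and> ({m, k} \<notin> edges N \<longrightarrow> f c m k = 0)) \<and>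
     (\<forall>c\<in>C. src c \<noteq> dst c \<longrightarrow> (\<forall>m\<in>nodes N.
        (\<Sum>k\<in>nodes N. f c m k) - (\<Sum>k\<in>nodes N. f c k m) =
          (if m = src c then rate c else if m = dst c then - rate c else 0))) \<and>
     (\<forall>c\<in>C. \<forall>k. f c (dst c) k = 0) \<and>
     (\<forall>m k. {m, k} \<in> edges N \<longrightarrow> (\<Sum>c\<in>C. f c m k + f c k m) \<le> real (cap N {m, k}))}"

definition lambda_star :: "'v network \<Rightarrow> real" where
  "lambda_star N = Sup {l. 0 \<le> l \<and>
     (\<lambda>_. l) \<in> flow_region N {Raw1, Raw2, Processed} (source N) (sink N) \<and>
     l \<le> real (comp_cap N)}"

subsection \<open>Policy \<open>\<pi>\<^sub>1\<close>\<close>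

text \<open>The tag \<open>(t, j)\<close> belongs to the \<open>j\<close>-th query arriving in slot \<open>t\<close>. Since a query
  has one packet of each class, the packets of a class at a node are given by their set of tags.\<close>

type_synonym tag = "nat \<times> nat"

definition new_tags :: "nat \<Rightarrow> nat \<Rightarrow> tag set" where
  "new_tags t a = {t} \<times> {..<a}"

text \<open>\<open>cs e\<close> is the class selected on the undirected edge \<open>e\<close>, one for both directions; ties are
  broken arbitrarily.\<close>

definition bp_choice ::
  "'v network \<Rightarrow> ('v set \<Rightarrow> data_class set) \<Rightarrow> (data_class \<Rightarrow> 'v \<Rightarrow> nat)
     \<Rightarrow> ('v set \<Rightarrow> data_class) \<Rightarrow> bool" where
  "bp_choice N carr Q cs \<longleftrightarrow> (\<forall>m k. {m, k} \<in> edges N \<longrightarrow>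
     cs {m, k} \<in> carr {m, k} \<and>
     (\<forall>c\<in>carr {m, k}. \<bar>int (Q c m) - int (Q c k)\<bar>
        \<le> \<bar>int (Q (cs {m, k}) m) - int (Q (cs {m, k}) k)\<bar>))"

definition bp_service ::
  "'v network \<Rightarrow> (data_class \<Rightarrow> 'v \<Rightarrow> nat) \<Rightarrow> ('v set \<Rightarrow> data_class)
     \<Rightarrow> data_class \<Rightarrow> 'v \<Rightarrow> 'v \<Rightarrow> nat" where
  "bp_service N Q cs c m k =
     (if {m, k} \<in> edges N \<and> c = cs {m, k} \<and> Q c m > Q c k then cap N {m, k} else 0)"

text \<open>\<open>mv c m k\<close> is the set of class \<open>c\<close> packets sent from \<open>m\<close> to \<open>k\<close>. If the service
  allocated at \<open>m\<close> does not exceed the backlog, the last condition forces every link to move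
  exactly \<open>U c m k\<close> packets; otherwise all waiting packets leave, split arbitrarily among the
  links within their service.\<close>

definition bp_moves ::
  "'v network \<Rightarrow> (data_class \<Rightarrow> 'v \<Rightarrow> 'v \<Rightarrow> nat) \<Rightarrow> (data_class \<Rightarrow> 'v \<Rightarrow> tag set)
     \<Rightarrow> (data_class \<Rightarrow> 'v \<Rightarrow> 'v \<Rightarrow> tag set) \<Rightarrow> bool" where
  "bp_moves N U B mv \<longleftrightarrow> (\<forall>c. \<forall>m\<in>nodes N.
     (\<forall>k\<in>nodes N. mv c m k \<subseteq> B c m \<and> card (mv c m k) \<le> U c m k) \<and>
     disjoint_family_on (mv c m) (nodes N) \<and>
     (\<Sum>k\<in>nodes N. card (mv c m k)) = min (card (B c m)) (\<Sum>k\<in>nodes N. U c m k))"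

text \<open>One slot, from queue contents \<open>B\<close> and contents \<open>X\<close> of the combination buffers at the computation
  node (used for the raw classes only) to \<open>B'\<close> and \<open>X'\<close>. \<open>K\<close> is the set of tags combined in the slot.
  Everything arriving in a slot is available from the next slot on.\<close>

definition pi1_slot ::
  "'v network \<Rightarrow> ('v set \<Rightarrow> data_class set) \<Rightarrow> tag set
     \<Rightarrow> (data_class \<Rightarrow> 'v \<Rightarrow> tag set) \<Rightarrow> (data_class \<Rightarrow> tag set)
     \<Rightarrow> (data_class \<Rightarrow> 'v \<Rightarrow> tag set) \<Rightarrow> (data_class \<Rightarrow> tag set) \<Rightarrow> bool" where
  "pi1_slot N carr new B X B' X' \<longleftrightarrow> (\<exists>cs mv K.
     bp_choice N carr (\<lambda>c k. card (B c k)) cs \<and>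
     bp_moves N (bp_service N (\<lambda>c k. card (B c k)) cs) B mv \<and>
     K \<subseteq> X Raw1 \<inter> X Raw2 \<and>
     card K = min (card (X Raw1 \<inter> X Raw2)) (comp_cap N) \<and>
     (\<forall>c. \<forall>k\<in>nodes N. B' c k =
        (if k = sink N c then {}
         else (B c k - (\<Union>j\<in>nodes N. mv c k j)) \<union> (\<Union>j\<in>nodes N. mv c j k) \<union>
           (if k = source N c then (if c = Processed then K else new) else {}))) \<and>
     (\<forall>c\<in>{Raw1, Raw2}. X' c =
        (X c - K) \<union> (\<Union>j\<in>nodes N. mv c j (comp_node N)) \<union>
          (if source N c = comp_node N then new else {})))"

subsection \<open>Stochastic model\<close>

definition iid_arrivals :: "'w measure \<Rightarrow> (nat \<Rightarrow> 'w \<Rightarrow> nat) \<Rightarrow> bool" where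
  "iid_arrivals M A \<longleftrightarrow>
     prob_space.indep_vars M (\<lambda>_. count_space UNIV) A UNIV \<and>
     (\<forall>t. distr M (count_space UNIV) (A t) = distr M (count_space UNIV) (A 0))"

text \<open>Ties and the choice of packets may depend on the past and on extra randomness, but not on
  future arrivals: the state at the beginning of slot \<open>t\<close> is measurable with respect to a history \<open>F t\<close>
  which is independent of \<open>A t\<close>.\<close>

definition nonanticipating ::
  "'w measure \<Rightarrow> (nat \<Rightarrow> 'w measure) \<Rightarrow> 'v network \<Rightarrow> (nat \<Rightarrow> 'w \<Rightarrow> nat)
     \<Rightarrow> (nat \<Rightarrow> 'w \<Rightarrow> data_class \<Rightarrow> 'v \<Rightarrow> tag set) \<Rightarrow> (nat \<Rightarrow> 'w \<Rightarrow> data_class \<Rightarrow> tag set) \<Rightarrow> bool" where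
  "nonanticipating M F N A B X \<longleftrightarrow>
     filtration (space M) F \<and> (\<forall>t. subalgebra M (F t)) \<and>
     (\<forall>t. A t \<in> measurable (F (Suc t)) (count_space UNIV)) \<and>
     (\<forall>t. prob_space.indep_set M (sets (F t))
        (sets (vimage_algebra (space M) (A t) (count_space UNIV)))) \<and>
     (\<forall>t c q. \<forall>k\<in>nodes N. {\<omega>\<in>space M. q \<in> B t \<omega> c k} \<in> sets (F t)) \<and>
     (\<forall>t q. \<forall>c\<in>{Raw1, Raw2}. {\<omega>\<in>space M. q \<in> X t \<omega> c} \<in> sets (F t))"

definition pi1_process ::
  "'w measure \<Rightarrow> 'v network \<Rightarrow> ('v set \<Rightarrow> data_class set) \<Rightarrow> (nat \<Rightarrow> 'w \<Rightarrow> nat)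
     \<Rightarrow> (nat \<Rightarrow> 'w \<Rightarrow> data_class \<Rightarrow> 'v \<Rightarrow> tag set) \<Rightarrow> (nat \<Rightarrow> 'w \<Rightarrow> data_class \<Rightarrow> tag set) \<Rightarrow> bool" where
  "pi1_process M N carr A B X \<longleftrightarrow> (\<forall>\<omega>\<in>space M.
     (\<forall>c. \<forall>k\<in>nodes N. B 0 \<omega> c k = {}) \<and> (\<forall>c\<in>{Raw1, Raw2}. X 0 \<omega> c = {}) \<and>
     (\<forall>t. pi1_slot N carr (new_tags t (A t \<omega>)) (B t \<omega>) (X t \<omega>) (B (Suc t) \<omega>) (X (Suc t) \<omega>)))"

text \<open>Expectations are taken in \<open>[0, \<infinity>]\<close>, so that an infinite mean is not mistaken for 0.\<close>

definition strongly_stable :: "'w measure \<Rightarrow> (nat \<Rightarrow> 'w \<Rightarrow> nat) \<Rightarrow> bool" where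
  "strongly_stable M Q \<longleftrightarrow>
     limsup (\<lambda>T. (\<Sum>t=1..T. \<integral>\<^sup>+\<omega>. of_nat (Q t \<omega>) \<partial>M) / of_nat T) < (\<infinity> :: ennreal)"

definition system_stable ::
  "'w measure \<Rightarrow> 'v network \<Rightarrow> (nat \<Rightarrow> 'w \<Rightarrow> data_class \<Rightarrow> 'v \<Rightarrow> tag set)
     \<Rightarrow> (nat \<Rightarrow> 'w \<Rightarrow> data_class \<Rightarrow> tag set) \<Rightarrow> bool" where
  "system_stable M N B X \<longleftrightarrow>
     (\<forall>c. \<forall>k\<in>nodes N. strongly_stable M (\<lambda>t \<omega>. card (B t \<omega> c k))) \<and>
     (\<forall>c\<in>{Raw1, Raw2}. strongly_stable M (\<lambda>t \<omega>. card (X t \<omega> c)))"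

end

theory Submission
  imports Defs
begin

text \<open>
  Every link moves the class of largest backlog difference, so if a flow of rate \<open>l\<close> exists, the total
  pressure \<open>W = \<Sum> cap * \<bar>\<Delta>Q\<bar>\<close> relieved by backpressure is at least \<open>l\<close> times the backlog at the
  sources; it also bounds every single queue up to a constant, by following a path to the sink. For
  \<open>lam < l\<close> a fraction of \<open>W\<close> is thus left over, and the sum of the squared raw queues has negative
  drift. Next, the number \<open>Z\<close> of queries not yet combined exceeds the number of waiting pairs by at most
  the raw backlog; so \<open>C\<close> pairs are combined whenever \<open>Z\<close> exceeds \<open>C\<close> plus the raw backlog, and the
  drift of \<open>Z\<^sup>2\<close> is negative up to a multiple of that backlog. Finally, the
  combinations feeding the processed network are neither independent nor of rate \<open>lam\<close> in
  each slot. Adding \<open>2 Q Z\<close>, with \<open>Q\<close> the processed queue at the computation node, to the sum of the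
  squared processed queues replaces them by the query arrivals in the drift, at the cost of a multiple
  of \<open>Z\<close>, which is already controlled.
\<close>

subsection \<open>Flows and potentials\<close>

definition class_edges :: "'v set set \<Rightarrow> 'v set set \<Rightarrow> data_class \<Rightarrow> 'v set set" where
  "class_edges E1 E2 c = (if c = Processed then E2 else E1)"

definition class_nodes :: "'v set \<Rightarrow> 'v set \<Rightarrow> data_class \<Rightarrow> 'v set" where
  "class_nodes V1 V2 c = (if c = Processed then V2 else V1)"

text \<open>Flow conservation is tested against potentials \<open>\<phi>\<close>; for a class whose source is its sink, where
  the flow region requires no conservation, the zero flow satisfies it.\<close>

definition supports ::
  "'v network \<Rightarrow> real \<Rightarrow> (data_class \<Rightarrow> 'v \<Rightarrow> 'v \<Rightarrow> real) \<Rightarrow> bool" where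
  "supports N l f \<longleftrightarrow>
     (\<forall>c m k. f c m k \<ge> 0 \<and> ({m, k} \<notin> edges N \<longrightarrow> f c m k = 0)) \<and>
     (\<forall>c (\<phi> :: 'v \<Rightarrow> real). l * (\<phi> (source N c) - \<phi> (sink N c)) =
        (\<Sum>m\<in>nodes N. \<Sum>k\<in>nodes N. f c m k * (\<phi> m - \<phi> k))) \<and>
     (\<forall>m k. {m, k} \<in> edges N \<longrightarrow> (\<Sum>c\<in>UNIV. f c m k + f c k m) \<le> real (cap N {m, k}))"

lemma UNIV_data_class: "(UNIV :: data_class set) = {Raw1, Raw2, Processed}"
  using data_class.exhaust by auto

instance data_class :: finite
  by standard (simp add: UNIV_data_class)

locale split_network =
  fixes N :: "'v network" and V1 V2 :: "'v set" and E1 E2 :: "'v set set"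
  assumes wf: "wf_network N"
    and split: "non_overlapping N V1 E1 V2 E2"
begin

abbreviation "edges_of \<equiv> class_edges E1 E2"
abbreviation "nodes_of \<equiv> class_nodes V1 V2"

lemma finite_nodes [simp]: "finite (nodes N)"
  using wf by (simp add: wf_network_def)

lemma end_points_in_nodes [simp]: "source N c \<in> nodes N" "sink N c \<in> nodes N"
  using wf by (cases c; simp add: wf_network_def)+

lemma end_points_in_nodes_of: "source N c \<in> nodes_of c" "sink N c \<in> nodes_of c"
  using split by (cases c; auto simp: non_overlapping_def class_nodes_def)+

lemma comp_in_nodes [simp]: "comp_node N \<in> nodes N"
  using wf by (simp add: wf_network_def)

lemma edge_nodes: "{m, k} \<in> edges N \<Longrightarrow> m \<in> nodes N \<and> k \<in> nodes N"
  using wf by (force simp: wf_network_def doubleton_eq_iff)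

lemma edges_of_subset: "edges_of c \<subseteq> edges N"
  using split by (auto simp: non_overlapping_def class_edges_def)

text \<open>A common edge would lie inside \<open>V1 \<inter> V2\<close>, which is a single node,
  whereas an edge has two distinct end points. Raw and processed classes therefore never compete for
  a link.\<close>

lemma edges_disjoint: "E1 \<inter> E2 = {}"
proof (rule ccontr)
  assume "E1 \<inter> E2 \<noteq> {}"
  then obtain e where e: "e \<in> E1" "e \<in> E2" by blast
  with split have sub: "e \<subseteq> {comp_node N}" and "e \<in> edges N"
    unfolding non_overlapping_def by blast+
  with wf obtain m k where "m \<noteq> k" "e = {m, k}"
    unfolding wf_network_def by blast
  with sub show False by blast
qed

lemma in_carried_iff: "c \<in> carried E1 E2 e \<longleftrightarrow> e \<in> edges_of c"
  by (cases c) (auto simp: carried_def class_edges_def)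

text \<open>Summation by parts: exchanging the two node sums turns flow times potential difference
  into net outflow times potential, and conservation leaves only the terms at source and
  sink.\<close>

lemma supportsI:
  assumes f: "\<And>c m k. f c m k \<ge> 0" "\<And>c m k. {m, k} \<notin> edges N \<Longrightarrow> f c m k = 0"
    and cons: "\<And>c m. source N c \<noteq> sink N c \<Longrightarrow> m \<in> nodes N \<Longrightarrow>
      (\<Sum>k\<in>nodes N. f c m k) - (\<Sum>k\<in>nodes N. f c k m) =
        (if m = source N c then l else if m = sink N c then - l else 0)"
    and triv: "\<And>c m k. source N c = sink N c \<Longrightarrow> f c m k = 0"
    and cap: "\<And>m k. {m, k} \<in> edges N \<Longrightarrow> (\<Sum>c\<in>UNIV. f c m k + f c k m) \<le> real (cap N {m, k})"
  shows "supports N l f"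
proof -
  have "l * (\<phi> (source N c) - \<phi> (sink N c)) =
        (\<Sum>m\<in>nodes N. \<Sum>k\<in>nodes N. f c m k * (\<phi> m - \<phi> k))" for c and \<phi> :: "'v \<Rightarrow> real"
  proof (cases "source N c = sink N c")
    case True then show ?thesis by (simp add: triv)
  next
    case False
    have "(\<Sum>m\<in>nodes N. \<Sum>k\<in>nodes N. f c m k * (\<phi> m - \<phi> k)) =
      (\<Sum>m\<in>nodes N. \<Sum>k\<in>nodes N. f c m k * \<phi> m) - (\<Sum>m\<in>nodes N. \<Sum>k\<in>nodes N. f c m k * \<phi> k)"
      by (simp add: right_diff_distrib sum_subtractf)
    also have "(\<Sum>m\<in>nodes N. \<Sum>k\<in>nodes N. f c m k * \<phi> k) = (\<Sum>m\<in>nodes N. \<Sum>k\<in>nodes N. f c k m * \<phi> m)"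
      by (rule sum.swap)
    also have "(\<Sum>m\<in>nodes N. \<Sum>k\<in>nodes N. f c m k * \<phi> m) - \<dots> =
      (\<Sum>m\<in>nodes N. ((\<Sum>k\<in>nodes N. f c m k) - (\<Sum>k\<in>nodes N. f c k m)) * \<phi> m)"
      by (simp add: left_diff_distrib sum_subtractf sum_distrib_right)
    also have "\<dots> = (\<Sum>m\<in>nodes N. (if m = source N c then l * \<phi> m else 0) +
        (if m = sink N c then - l * \<phi> m else 0))"
      using False by (intro sum.cong) (auto simp: cons)
    also have "\<dots> = l * \<phi> (source N c) - l * \<phi> (sink N c)"
      by (simp add: sum.distrib)
    finally show ?thesis by (simp add: right_diff_distrib)
  qed
  with f cap show ?thesis by (auto simp: supports_def)
qed

text \<open>The set of admissible rates contains 0 and is bounded by the computing capacity, so its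
  supremum is a genuine one and some admissible rate lies strictly above \<open>lam\<close>.\<close>

lemma lambda_star_flow:
  assumes "lam < lambda_star N" "0 \<le> lam"
  obtains l f where "lam < l" "l \<le> real (comp_cap N)" "supports N l f"
proof -
  let ?S = "{l. 0 \<le> l \<and>
     (\<lambda>_. l) \<in> flow_region N {Raw1, Raw2, Processed} (source N) (sink N) \<and>
     l \<le> real (comp_cap N)}"
  have "0 \<in> ?S" by (auto simp: flow_region_def intro!: exI[of _ "\<lambda>_ _ _. 0"])
  then have "?S \<noteq> {}" by blast
  moreover have "bdd_above ?S" by (rule bdd_aboveI[of _ "real (comp_cap N)"]) simp
  ultimately obtain l where l: "l \<in> ?S" "lam < l"
    using assms(1) less_cSup_iff[of ?S lam] unfolding lambda_star_def by blast
  then obtain f where "\<forall>c m k. f c m k \<ge> 0 \<and> ({m, k} \<notin> edges N \<longrightarrow> f c m k = 0)"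
    "\<forall>c. source N c \<noteq> sink N c \<longrightarrow> (\<forall>m\<in>nodes N.
      (\<Sum>k\<in>nodes N. f c m k) - (\<Sum>k\<in>nodes N. f c k m) =
        (if m = source N c then l else if m = sink N c then - l else 0))"
    "\<forall>m k. {m, k} \<in> edges N \<longrightarrow> (\<Sum>c\<in>UNIV. f c m k + f c k m) \<le> real (cap N {m, k})"
    unfolding flow_region_def UNIV_data_class[symmetric] by blast
  then have f: "f c m k \<ge> 0" "{m, k} \<notin> edges N \<Longrightarrow> f c m k = 0"
    "source N c \<noteq> sink N c \<Longrightarrow> m \<in> nodes N \<Longrightarrow>
      (\<Sum>k\<in>nodes N. f c m k) - (\<Sum>k\<in>nodes N. f c k m) =
        (if m = source N c then l else if m = sink N c then - l else 0)"
    "{m, k} \<in> edges N \<Longrightarrow> (\<Sum>c\<in>UNIV. f c m k + f c k m) \<le> real (cap N {m, k})" for c m k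
    by blast+
  \<comment> \<open>A class whose source is its sink is not subject to conservation in the flow
    region, so its flow may be anything there. Replacing it by the zero flow restores conservation
    and only frees capacity.\<close>
  define g where "g c m k = (if source N c = sink N c then 0 else f c m k)" for c m k
  have "supports N l g"
  proof (rule supportsI)
    fix m k assume e: "{m, k} \<in> edges N"
    have "(\<Sum>c\<in>UNIV. g c m k + g c k m) \<le> (\<Sum>c\<in>UNIV. f c m k + f c k m)"
      by (rule sum_mono) (simp add: g_def f(1))
    with f(4)[OF e] show "(\<Sum>c\<in>UNIV. g c m k + g c k m) \<le> real (cap N {m, k})" by simp
  qed (auto simp: g_def f)
  with l that show ?thesis by blast
qed

text \<open>Every undirected edge is counted in both orientations.\<close>

definition cap_weight :: "'v set set \<Rightarrow> ('v \<Rightarrow> 'v \<Rightarrow> real) \<Rightarrow> real" where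
  "cap_weight E w = (\<Sum>m\<in>nodes N. \<Sum>k\<in>nodes N. if {m, k} \<in> E then real (cap N {m, k}) * w m k else 0)"

lemma sum_symmetrize:
  fixes g :: "'v \<Rightarrow> 'v \<Rightarrow> real"
  shows "2 * (\<Sum>m\<in>A. \<Sum>k\<in>A. g m k) = (\<Sum>m\<in>A. \<Sum>k\<in>A. g m k + g k m)"
  using sum.swap[of g A A] by (simp add: sum.distrib)

text \<open>Extending \<open>q c\<close> to the other subnetwork by its value at the computation node gives a potential
  whose differences vanish on all edges that do not carry class \<open>c\<close>.\<close>

lemma flow_le_cap_weight:
  assumes f: "supports N l f" and Cs: "\<And>c. c \<in> Cs \<Longrightarrow> edges_of c = E"
    and w: "\<And>c m k. c \<in> Cs \<Longrightarrow> {m, k} \<in> E \<Longrightarrow> cap N {m, k} > 0 \<Longrightarrow> \<bar>q c m - q c k\<bar> \<le> w m k"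
    and w0: "\<And>m k. 0 \<le> w m k"
  shows "2 * l * (\<Sum>c\<in>Cs. q c (source N c) - q c (sink N c)) \<le> cap_weight E w"
proof -
  define \<phi> where "\<phi> c k = (if k \<in> nodes_of c then q c k else q c (comp_node N))" for c k
  have f0: "f c m k \<ge> 0" "{m, k} \<notin> edges N \<Longrightarrow> f c m k = 0" for c m k
    using f by (auto simp: supports_def)
  have cons: "l * (\<phi> c (source N c) - \<phi> c (sink N c)) =
        (\<Sum>m\<in>nodes N. \<Sum>k\<in>nodes N. f c m k * (\<phi> c m - \<phi> c k))" for c
    using f by (auto simp: supports_def)
  \<comment> \<open>An edge outside the subgraph of class \<open>c\<close> belongs to the other
    subnetwork, which meets the nodes of the class in the computation node only.\<close>
  have other: "\<phi> c m = q c (comp_node N)" if "e \<in> edges N" "e \<notin> edges_of c" "m \<in> e" for c m e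
  proof -
    have "m \<in> (if c = Processed then V1 else V2)"
      using that split by (auto simp: non_overlapping_def class_edges_def split: if_splits)
    moreover have "m = comp_node N" if "m \<in> V1" "m \<in> V2"
      using that split by (auto simp: non_overlapping_def)
    ultimately show ?thesis
      by (auto simp: \<phi>_def class_nodes_def non_overlapping_def split: if_splits)
  qed
  have same: "\<phi> c m = q c m" if "e \<in> edges_of c" "m \<in> e" for c m e
    using that split by (auto simp: \<phi>_def non_overlapping_def class_edges_def class_nodes_def split: if_splits)
  \<comment> \<open>The two orientations of an edge are treated together because they share one
    capacity.\<close>
  have edge: "(\<Sum>c\<in>Cs. f c m k * (\<phi> c m - \<phi> c k) + f c k m * (\<phi> c k - \<phi> c m))
      \<le> (if {m, k} \<in> E then real (cap N {m, k}) * w m k else 0)" for m k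
  proof (cases "{m, k} \<in> edges N")
    case False
    then have "{k, m} \<notin> edges N" by (simp add: insert_commute)
    with False have z: "f c m k = 0" "f c k m = 0" for c by (auto intro: f0)
    show ?thesis by (simp add: z w0)
  next
    case True
    show ?thesis
    proof (cases "{m, k} \<in> E")
      case False
      then have "\<phi> c m = \<phi> c k" if "c \<in> Cs" for c
        using other[OF True, of c m] other[OF True, of c k] Cs[OF that] by auto
      then show ?thesis using False by simp
    next
      case e: True
      have cap: "(\<Sum>c\<in>UNIV. f c m k + f c k m) \<le> real (cap N {m, k})"
        using f True by (auto simp: supports_def)
      have "(\<Sum>c\<in>Cs. f c m k * (\<phi> c m - \<phi> c k) + f c k m * (\<phi> c k - \<phi> c m))
          \<le> (\<Sum>c\<in>Cs. (f c m k + f c k m) * w m k)"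
      \<comment> \<open>The bound by \<open>w\<close> is assumed on edges of positive capacity only.
        On the others all flows vanish, being non-negative with sum at most 0.\<close>
      proof (cases "cap N {m, k} = 0")
        case True
        have "(\<Sum>c\<in>UNIV. f c m k + f c k m) = 0"
          using cap True f0(1) by (intro antisym sum_nonneg) auto
        then have "f c m k + f c k m = 0" for c
          using f0(1) by (subst (asm) sum_nonneg_eq_0_iff) (auto intro!: add_nonneg_nonneg)
        then have "f c m k = 0 \<and> f c k m = 0" for c
          using f0(1)[of c m k] f0(1)[of c k m] by (metis add_nonneg_eq_0_iff)
        then show ?thesis by simp
      next
        case False
        show ?thesis
        proof (rule sum_mono)
          fix c assume c: "c \<in> Cs"
          have "\<bar>\<phi> c m - \<phi> c k\<bar> \<le> w m k"
            using w[OF c e] same[of "{m, k}" c m] same[of "{m, k}" c k] e Cs[OF c] False by auto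
          then have "\<phi> c m - \<phi> c k \<le> w m k" "\<phi> c k - \<phi> c m \<le> w m k" by linarith+
          then have "f c m k * (\<phi> c m - \<phi> c k) \<le> f c m k * w m k"
            "f c k m * (\<phi> c k - \<phi> c m) \<le> f c k m * w m k"
            using f0(1) by (auto intro: mult_left_mono)
          then show "f c m k * (\<phi> c m - \<phi> c k) + f c k m * (\<phi> c k - \<phi> c m)
            \<le> (f c m k + f c k m) * w m k" by (simp add: distrib_right)
        qed
      qed
      also have "\<dots> = (\<Sum>c\<in>Cs. f c m k + f c k m) * w m k"
        by (simp add: sum_distrib_right)
      also have "\<dots> \<le> real (cap N {m, k}) * w m k"
      proof (rule mult_right_mono[OF _ w0])
        have "(\<Sum>c\<in>Cs. f c m k + f c k m) \<le> (\<Sum>c\<in>UNIV. f c m k + f c k m)"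
          by (rule sum_mono2) (auto intro: f0 add_nonneg_nonneg)
        with cap show "(\<Sum>c\<in>Cs. f c m k + f c k m) \<le> real (cap N {m, k})" by simp
      qed
      finally show ?thesis using e by simp
    qed
  qed
  have "2 * l * (\<Sum>c\<in>Cs. q c (source N c) - q c (sink N c)) =
      (\<Sum>c\<in>Cs. 2 * (l * (\<phi> c (source N c) - \<phi> c (sink N c))))"
    using end_points_in_nodes_of by (simp add: \<phi>_def sum_distrib_left mult.assoc)
  also have "\<dots> = (\<Sum>c\<in>Cs. \<Sum>m\<in>nodes N. \<Sum>k\<in>nodes N.
      f c m k * (\<phi> c m - \<phi> c k) + f c k m * (\<phi> c k - \<phi> c m))"
    by (simp add: cons sum_symmetrize)
  also have "\<dots> = (\<Sum>m\<in>nodes N. \<Sum>c\<in>Cs. \<Sum>k\<in>nodes N.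
      f c m k * (\<phi> c m - \<phi> c k) + f c k m * (\<phi> c k - \<phi> c m))"
    by (rule sum.swap)
  also have "\<dots> = (\<Sum>m\<in>nodes N. \<Sum>k\<in>nodes N. \<Sum>c\<in>Cs.
      f c m k * (\<phi> c m - \<phi> c k) + f c k m * (\<phi> c k - \<phi> c m))"
    by (intro sum.cong refl sum.swap)
  also have "\<dots> \<le> cap_weight E w"
    unfolding cap_weight_def by (intro sum_mono edge)
  finally show ?thesis .
qed

section \<open>Usable links, and bounding a queue along a path to the sink\<close>

definition links :: "data_class \<Rightarrow> ('v \<times> 'v) set" where
  "links c = {(m, k). {m, k} \<in> edges_of c \<and> cap N {m, k} > 0}"

definition reach :: "data_class \<Rightarrow> 'v set" where
  "reach c = {k. (source N c, k) \<in> (links c)\<^sup>*}"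

lemma sym_links: "sym (links c)"
  by (auto simp: links_def sym_def insert_commute)

text \<open>Otherwise the indicator of the reachable set would be a potential that separates the source
  from the sink and is constant along every usable edge.\<close>

lemma sink_in_reach:
  assumes f: "supports N l f" and l: "l > 0"
  shows "sink N c \<in> reach c"
proof (rule ccontr)
  assume no: "sink N c \<notin> reach c"
  have "2 * l * (\<Sum>c'\<in>{c}. indicator (reach c') (source N c') - indicator (reach c') (sink N c'))
      \<le> cap_weight (edges_of c) (\<lambda>_ _. 0)"
  proof (rule flow_le_cap_weight[OF f])
    fix c' m k assume "c' \<in> {c}" and e: "{m, k} \<in> edges_of c" "cap N {m, k} > 0"
    then have "(m, k) \<in> links c'" "(k, m) \<in> links c'"
      by (auto simp: links_def insert_commute)
    then have "m \<in> reach c' \<longleftrightarrow> k \<in> reach c'"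
      unfolding reach_def by (auto intro: rtrancl.rtrancl_into_rtrancl)
    then show "\<bar>indicator (reach c') m - indicator (reach c') k\<bar> \<le> (0::real)"
      by (simp add: indicator_def)
  qed auto
  moreover have "source N c \<in> reach c" by (simp add: reach_def)
  moreover have "cap_weight (edges_of c) (\<lambda>_ _. 0) = 0"
    by (simp add: cap_weight_def cong: if_cong)
  ultimately show False using no l by simp
qed

text \<open>Capacities are integers, so a positive one is at least 1 and a single summand of the
  non-negative sum already dominates \<open>w m k\<close>.\<close>

lemma weight_le_cap_weight:
  assumes "{m, k} \<in> E" "E \<subseteq> edges N" "cap N {m, k} > 0" "\<And>m k. 0 \<le> w m k"
  shows "w m k \<le> cap_weight E w"
proof -
  have mk: "m \<in> nodes N" "k \<in> nodes N" using edge_nodes assms by auto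
  let ?g = "\<lambda>m k. if {m, k} \<in> E then real (cap N {m, k}) * w m k else 0"
  have g: "?g m k \<ge> 0" for m k using assms by simp
  have "w m k \<le> ?g m k" using assms mult_right_mono[of 1 "real (cap N {m, k})" "w m k"] by simp
  also have "\<dots> \<le> (\<Sum>k\<in>nodes N. ?g m k)" by (rule member_le_sum[OF mk(2) g]) simp
  also have "\<dots> \<le> cap_weight E w" unfolding cap_weight_def
    by (rule member_le_sum[OF mk(1), where f = "\<lambda>m. \<Sum>k\<in>nodes N. ?g m k"]) (auto intro!: sum_nonneg g)
  finally show ?thesis .
qed

text \<open>These are the properties of queue lengths that the path argument uses: the queue is
  pinned to 0 at the sink and at nodes its packets cannot reach. The bound \<open>b\<close> will be
  the total pressure.\<close>

definition gradient_bound :: "data_class \<Rightarrow> real \<Rightarrow> ('v \<Rightarrow> real) \<Rightarrow> bool" where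
  "gradient_bound c b q \<longleftrightarrow> q (sink N c) = 0 \<and> (\<forall>k\<in>nodes N - reach c. q k = 0) \<and>
     (\<forall>m k. (m, k) \<in> links c \<longrightarrow> \<bar>q m - q k\<bar> \<le> b)"

text \<open>Starting from the value 0 at the sink, differences of at most \<open>b\<close> add up
  along a path to \<open>k\<close>, so \<open>D\<close> counts the links of that path. The path
  exists because usable links are symmetric and both the sink and \<open>k\<close> are reachable
  from the source; it depends neither on \<open>b\<close> nor on \<open>q\<close>.\<close>

lemma gradient_bound_node:
  assumes "supports N l f" "l > 0" "k \<in> nodes N"
  shows "\<exists>D\<ge>0. \<forall>b\<ge>0. \<forall>q. gradient_bound c b q \<longrightarrow> q k \<le> D * b"
proof (cases "k \<in> reach c")
  case False
  with assms(3) show ?thesis by (intro exI[of _ 0]) (auto simp: gradient_bound_def)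
next
  case True
  have "(sink N c, source N c) \<in> (links c)\<^sup>*"
    using sink_in_reach[OF assms(1,2), of c] sym_rtrancl[OF sym_links, of c]
    unfolding reach_def by (auto dest: symD)
  with True have "(sink N c, k) \<in> (links c)\<^sup>*" by (simp add: reach_def)
  then show ?thesis
  proof (induction rule: rtrancl_induct)
    case base
    then show ?case by (intro exI[of _ 0]) (auto simp: gradient_bound_def)
  next
    case (step y z)
    then obtain D where D: "D \<ge> 0" "\<And>b q. b \<ge> 0 \<Longrightarrow> gradient_bound c b q \<Longrightarrow> q y \<le> D * b" by blast
    show ?case
    proof (intro exI[of _ "D + 1"] conjI allI impI)
      fix b q assume b: "b \<ge> (0::real)" and g: "gradient_bound c b q"
      with step have "\<bar>q y - q z\<bar> \<le> b" by (auto simp: gradient_bound_def)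
      with D(2)[OF b g] show "q z \<le> (D + 1) * b" by (simp add: distrib_right)
    qed (use D in auto)
  qed
qed

lemma gradient_bound_sum:
  assumes "supports N l f" "l > 0"
  obtains D where "D > 0" "\<And>b q. b \<ge> 0 \<Longrightarrow> (\<And>c. c \<in> Cs \<Longrightarrow> gradient_bound c b (q c)) \<Longrightarrow>
    (\<Sum>c\<in>Cs. \<Sum>k\<in>nodes N. q c k) \<le> D * b"
proof -
  let ?P = "\<lambda>c k D. D \<ge> 0 \<and> (k \<in> nodes N \<longrightarrow> (\<forall>b\<ge>0. \<forall>q. gradient_bound c b q \<longrightarrow> q k \<le> D * b))"
  have ex: "\<exists>D. ?P c k D" for c k
    using gradient_bound_node[OF assms, of k c] by (cases "k \<in> nodes N") auto
  define D where "D c k = (SOME D. ?P c k D)" for c k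
  have "?P c k (D c k)" for c k unfolding D_def by (rule someI_ex[OF ex])
  then have D: "D c k \<ge> 0"
    "k \<in> nodes N \<Longrightarrow> b \<ge> 0 \<Longrightarrow> gradient_bound c b q \<Longrightarrow> q k \<le> D c k * b" for c k b q
    by blast+
  show ?thesis
  proof
    \<comment> \<open>The added 1 makes the constant strictly positive, since it is divided by
      later.\<close>
    show "(\<Sum>c\<in>Cs. \<Sum>k\<in>nodes N. D c k) + 1 > 0"
      using D(1) by (smt (verit) sum_nonneg)
  next
    fix b and q :: "data_class \<Rightarrow> 'v \<Rightarrow> real" assume b: "b \<ge> 0" and g: "\<And>c. c \<in> Cs \<Longrightarrow> gradient_bound c b (q c)"
    have "(\<Sum>c\<in>Cs. \<Sum>k\<in>nodes N. q c k) \<le> (\<Sum>c\<in>Cs. \<Sum>k\<in>nodes N. D c k * b)"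
      by (intro sum_mono D(2) b g)
    also have "\<dots> \<le> ((\<Sum>c\<in>Cs. \<Sum>k\<in>nodes N. D c k) + 1) * b"
      using b by (simp add: sum_distrib_right distrib_right)
    finally show "(\<Sum>c\<in>Cs. \<Sum>k\<in>nodes N. q c k) \<le> ((\<Sum>c\<in>Cs. \<Sum>k\<in>nodes N. D c k) + 1) * b" .
  qed
qed

end

subsection \<open>Drift in one slot\<close>

text \<open>The quadratic drift of a queue with service \<open>u\<close> and arrivals
  \<open>y\<close>. Truncated subtraction is harmless: the remainder is at most \<open>x\<close>,
  and its square is at most that of the untruncated difference even if the service exceeds the
  backlog.\<close>

lemma square_step:
  fixes x x' u y :: nat
  assumes "x' \<le> x - u + y"
  shows "(real x')\<^sup>2 \<le> (real x)\<^sup>2 + (real u)\<^sup>2 + (real y)\<^sup>2 + 2 * real x * (real y - real u)"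
proof -
  let ?z = "real (x - u)"
  have z: "?z \<le> real x" "?z\<^sup>2 \<le> (real x - real u)\<^sup>2"
    by (cases "u \<le> x"; simp add: of_nat_diff)+
  have "real x' \<le> ?z + real y" using assms by linarith
  then have "(real x')\<^sup>2 \<le> (?z + real y)\<^sup>2" by (intro power_mono) auto
  also have "\<dots> = ?z\<^sup>2 + 2 * ?z * real y + (real y)\<^sup>2" by (simp add: power2_sum)
  also have "\<dots> \<le> (real x - real u)\<^sup>2 + 2 * real x * real y + (real y)\<^sup>2"
    using z by (intro add_mono mult_mono) auto
  finally show ?thesis by (simp add: power2_diff algebra_simps)
qed

text \<open>\<open>pi1_slot\<close> with its witnesses exposed, so that all facts about a slot refer
  to the same class selection, the same moves and the same combined tags.\<close>

definition slot_by where
  "slot_by N carr new B X B' X' cs mv K \<longleftrightarrow>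
     bp_choice N carr (\<lambda>c k. card (B c k)) cs \<and>
     bp_moves N (bp_service N (\<lambda>c k. card (B c k)) cs) B mv \<and>
     K \<subseteq> X Raw1 \<inter> X Raw2 \<and>
     card K = min (card (X Raw1 \<inter> X Raw2)) (comp_cap N) \<and>
     (\<forall>c. \<forall>k\<in>nodes N. B' c k =
        (if k = sink N c then {}
         else (B c k - (\<Union>j\<in>nodes N. mv c k j)) \<union> (\<Union>j\<in>nodes N. mv c j k) \<union>
           (if k = source N c then (if c = Processed then K else new) else {}))) \<and>
     (\<forall>c\<in>{Raw1, Raw2}. X' c =
        (X c - K) \<union> (\<Union>j\<in>nodes N. mv c j (comp_node N)) \<union>
          (if source N c = comp_node N then new else {}))"

lemma pi1_slot_iff: "pi1_slot N carr new B X B' X' \<longleftrightarrow> (\<exists>cs mv K. slot_by N carr new B X B' X' cs mv K)"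
  by (simp add: pi1_slot_def slot_by_def)

section \<open>State invariant, groups of competing classes and the gain of backpressure\<close>

context split_network
begin

text \<open>For a raw class, these are the tags of the queries not yet combined, wherever the packet
  is. Only raw classes are meant, as \<open>X\<close> is unconstrained for
  \<open>Processed\<close>.\<close>

definition outstanding ::
  "(data_class \<Rightarrow> 'v \<Rightarrow> tag set) \<Rightarrow> (data_class \<Rightarrow> tag set) \<Rightarrow> data_class \<Rightarrow> tag set" where
  "outstanding B X c = X c \<union> (\<Union>k\<in>nodes N. B c k)"

text \<open>The invariant of the process, with \<open>T\<close> the tags generated so far. Each raw
  packet is in one place, so combining a tag removes it from the outstanding set altogether, and the
  two raw classes have the same outstanding tags. Processed queues enter only through upper bounds
  on their sizes.\<close>

definition consistent ::
  "tag set \<Rightarrow> (data_class \<Rightarrow> 'v \<Rightarrow> tag set) \<Rightarrow> (data_class \<Rightarrow> tag set) \<Rightarrow> bool" where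
  "consistent T B X \<longleftrightarrow> finite T \<and>
     (\<forall>c. \<forall>k\<in>nodes N. B c k \<subseteq> T \<and> (k \<notin> reach c \<or> k = sink N c \<longrightarrow> B c k = {})) \<and>
     (\<forall>c\<in>{Raw1, Raw2}. X c \<subseteq> T \<and> disjoint_family_on (B c) (nodes N) \<and>
       (\<forall>k\<in>nodes N. B c k \<inter> X c = {})) \<and>
     outstanding B X Raw1 = outstanding B X Raw2"

definition total_cap :: real where
  "total_cap = (\<Sum>m\<in>nodes N. \<Sum>k\<in>nodes N. real (cap N {m, k}))"

definition backlog :: "data_class set \<Rightarrow> (data_class \<Rightarrow> 'v \<Rightarrow> tag set) \<Rightarrow> real" where
  "backlog Cs B = (\<Sum>c\<in>Cs. \<Sum>k\<in>nodes N. real (card (B c k)))"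

definition backlog_sq :: "data_class set \<Rightarrow> (data_class \<Rightarrow> 'v \<Rightarrow> tag set) \<Rightarrow> real" where
  "backlog_sq Cs B = (\<Sum>c\<in>Cs. \<Sum>k\<in>nodes N. (real (card (B c k)))\<^sup>2)"

lemma total_cap_nonneg: "total_cap \<ge> 0"
  unfolding total_cap_def by (intro sum_nonneg) simp

text \<open>Classes that have all their edges in common and share none with a class outside the
  group. The class selected on an edge of \<open>E\<close> is then a member of \<open>Cs\<close>,
  which lets raw and processed drift be treated separately.\<close>

definition class_group :: "data_class set \<Rightarrow> 'v set set \<Rightarrow> bool" where
  "class_group Cs E \<longleftrightarrow> (\<forall>c\<in>Cs. edges_of c = E) \<and> (\<forall>c. c \<notin> Cs \<longrightarrow> edges_of c \<inter> E = {}) \<and> E \<subseteq> edges N"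

lemma raw_group: "class_group {Raw1, Raw2} E1"
  and processed_group: "class_group {Processed} E2"
  using edges_disjoint split
  by (auto simp: class_group_def class_edges_def non_overlapping_def intro: data_class.exhaust)

definition pressure :: "(data_class \<Rightarrow> 'v \<Rightarrow> nat) \<Rightarrow> ('v set \<Rightarrow> data_class) \<Rightarrow> 'v \<Rightarrow> 'v \<Rightarrow> real" where
  "pressure q cs m k = \<bar>real (q (cs {m, k}) m) - real (q (cs {m, k}) k)\<bar>"

text \<open>To first order, half the decrease of the sum of squared queues of class \<open>c\<close>
  caused by the allocated service.\<close>

definition gain :: "(data_class \<Rightarrow> 'v \<Rightarrow> nat) \<Rightarrow> ('v set \<Rightarrow> data_class) \<Rightarrow> data_class \<Rightarrow> real" where
  "gain q cs c = (\<Sum>m\<in>nodes N. \<Sum>k\<in>nodes N. real (bp_service N q cs c m k) * (real (q c m) - real (q c k)))"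

text \<open>Each edge of the group serves exactly one class of the group, and serves it from the
  longer queue to the shorter one. Adding both orientations thus yields the capacity times the
  absolute difference for the selected class.\<close>

lemma gain_eq_cap_weight:
  assumes g: "class_group Cs E" and ch: "bp_choice N (carried E1 E2) q cs"
  shows "2 * (\<Sum>c\<in>Cs. gain q cs c) = cap_weight E (pressure q cs)"
proof -
  let ?h = "\<lambda>c m k. real (bp_service N q cs c m k) * (real (q c m) - real (q c k))"
  have sym: "?h c m k + ?h c k m =
      (if {m, k} \<in> edges N \<and> c = cs {m, k} then real (cap N {m, k}) * pressure q cs m k else 0)" for c m k
    by (auto simp: bp_service_def pressure_def insert_commute)
  have edge: "(\<Sum>c\<in>Cs. ?h c m k + ?h c k m) =
      (if {m, k} \<in> E then real (cap N {m, k}) * pressure q cs m k else 0)" for m k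
  proof (cases "{m, k} \<in> edges N")
    case True
    then have "{m, k} \<in> edges_of (cs {m, k})"
      using ch by (auto simp: bp_choice_def in_carried_iff)
    then have "cs {m, k} \<in> Cs \<longleftrightarrow> {m, k} \<in> E" using g unfolding class_group_def by blast
    with True show ?thesis by (simp add: sym sum.delta finite)
  next
    case False
    then show ?thesis using g by (auto simp: sym class_group_def)
  qed
  have "2 * (\<Sum>c\<in>Cs. gain q cs c) = (\<Sum>c\<in>Cs. 2 * (\<Sum>m\<in>nodes N. \<Sum>k\<in>nodes N. ?h c m k))"
    by (simp add: gain_def sum_distrib_left)
  also have "\<dots> = (\<Sum>c\<in>Cs. \<Sum>m\<in>nodes N. \<Sum>k\<in>nodes N. ?h c m k + ?h c k m)"
    by (simp only: sum_symmetrize)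
  also have "\<dots> = (\<Sum>m\<in>nodes N. \<Sum>c\<in>Cs. \<Sum>k\<in>nodes N. ?h c m k + ?h c k m)"
    by (rule sum.swap)
  also have "\<dots> = (\<Sum>m\<in>nodes N. \<Sum>k\<in>nodes N. \<Sum>c\<in>Cs. ?h c m k + ?h c k m)"
    by (intro sum.cong refl sum.swap)
  also have "\<dots> = cap_weight E (pressure q cs)"
    unfolding cap_weight_def by (simp only: edge)
  finally show ?thesis .
qed

lemma pressure_nonneg: "pressure q cs m k \<ge> 0"
  by (simp add: pressure_def)

lemma pressure_ge:
  assumes "bp_choice N (carried E1 E2) q cs" "{m, k} \<in> edges_of c"
  shows "\<bar>real (q c m) - real (q c k)\<bar> \<le> pressure q cs m k"
proof -
  have "{m, k} \<in> edges N" "c \<in> carried E1 E2 {m, k}"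
    using assms(2) edges_of_subset by (auto simp: in_carried_iff)
  with assms(1) have "\<bar>int (q c m) - int (q c k)\<bar> \<le> \<bar>int (q (cs {m, k}) m) - int (q (cs {m, k}) k)\<bar>"
    by (auto simp: bp_choice_def)
  then have "real_of_int \<bar>int (q c m) - int (q c k)\<bar> \<le> real_of_int \<bar>int (q (cs {m, k}) m) - int (q (cs {m, k}) k)\<bar>"
    by (simp only: of_int_le_iff)
  then show ?thesis by (simp add: pressure_def)
qed

text \<open>Let \<open>W\<close> be the weighted pressure; the gain is \<open>W / 2\<close>. The
  flow bounds the source backlog by \<open>W / (2 * l)\<close>, and paths bound the total backlog by
  \<open>D * W\<close>. The share \<open>lam / l\<close> of the gain pays for arrivals at rate
  \<open>lam\<close>, and the rest pays for the term in the total backlog.\<close>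

lemma backpressure_gain:
  assumes f: "supports N l f" "lam < l" "0 \<le> lam" and g: "class_group Cs E"
  obtains \<epsilon> where "\<epsilon> > 0" "\<And>q cs. bp_choice N (carried E1 E2) q cs \<Longrightarrow>
    (\<And>c k. c \<in> Cs \<Longrightarrow> k \<in> nodes N \<Longrightarrow> k \<notin> reach c \<or> k = sink N c \<Longrightarrow> q c k = 0) \<Longrightarrow>
    lam * (\<Sum>c\<in>Cs. real (q c (source N c))) + \<epsilon> * (\<Sum>c\<in>Cs. \<Sum>k\<in>nodes N. real (q c k))
      \<le> (\<Sum>c\<in>Cs. gain q cs c)"
proof -
  have l: "l > 0" using f by simp
  obtain D where D: "D > 0" "\<And>b q. b \<ge> 0 \<Longrightarrow> (\<And>c. c \<in> Cs \<Longrightarrow> gradient_bound c b (q c)) \<Longrightarrow>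
    (\<Sum>c\<in>Cs. \<Sum>k\<in>nodes N. q c k) \<le> D * b"
    using gradient_bound_sum[OF f(1) l] by blast
  show ?thesis
  proof
    show "(1 - lam / l) / (2 * D) > 0" using f l D by simp
  next
    fix q cs
    assume ch: "bp_choice N (carried E1 E2) q cs"
      and z: "\<And>c k. c \<in> Cs \<Longrightarrow> k \<in> nodes N \<Longrightarrow> k \<notin> reach c \<or> k = sink N c \<Longrightarrow> q c k = 0"
    let ?W = "cap_weight E (pressure q cs)" and ?S = "\<Sum>c\<in>Cs. real (q c (source N c))"
      and ?Q = "\<Sum>c\<in>Cs. \<Sum>k\<in>nodes N. real (q c k)"
    have E: "c \<in> Cs \<Longrightarrow> edges_of c = E" for c using g by (auto simp: class_group_def)
    have W0: "?W \<ge> 0" unfolding cap_weight_def by (intro sum_nonneg) (simp add: pressure_nonneg)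
    have "2 * l * (\<Sum>c\<in>Cs. real (q c (source N c)) - real (q c (sink N c))) \<le> ?W"
    proof (rule flow_le_cap_weight[OF f(1)])
      show "\<bar>real (q c m) - real (q c k)\<bar> \<le> pressure q cs m k" if "c \<in> Cs" "{m, k} \<in> E" for c m k
        using that E by (intro pressure_ge[OF ch]) simp
    qed (auto simp: E pressure_nonneg)
    then have S: "2 * l * ?S \<le> ?W" using z by simp
    have Q: "?Q \<le> D * ?W"
    proof (rule D(2)[OF W0])
      fix c assume c: "c \<in> Cs"
      have "\<bar>real (q c m) - real (q c k)\<bar> \<le> ?W" if "(m, k) \<in> links c" for m k
      proof -
        have mk: "{m, k} \<in> E" "cap N {m, k} > 0" using that E[OF c] by (auto simp: links_def)
        have "\<bar>real (q c m) - real (q c k)\<bar> \<le> pressure q cs m k"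
          using mk E[OF c] by (intro pressure_ge[OF ch]) simp
        also have "\<dots> \<le> ?W"
          using mk g by (intro weight_le_cap_weight) (auto simp: class_group_def pressure_nonneg)
        finally show ?thesis .
      qed
      with z[OF c] show "gradient_bound c ?W (\<lambda>k. real (q c k))" by (auto simp: gradient_bound_def)
    qed
    have "lam * ?S = (lam / l) * (2 * l * ?S) / 2" using l by simp
    also have "\<dots> \<le> (lam / l) * ?W / 2"
      using S f l by (intro divide_right_mono mult_left_mono) auto
    finally have 1: "lam * ?S \<le> (lam / l) * ?W / 2" .
    have "(1 - lam / l) / (2 * D) * ?Q \<le> (1 - lam / l) / (2 * D) * (D * ?W)"
      using Q f l D by (intro mult_left_mono) auto
    also have "\<dots> = (1 - lam / l) * ?W / 2" using D by simp
    finally have "(1 - lam / l) / (2 * D) * ?Q \<le> (1 - lam / l) * ?W / 2" .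
    moreover have "(1 - lam / l) * ?W / 2 = ?W / 2 - (lam / l) * ?W / 2"
      by (simp add: left_diff_distrib diff_divide_distrib)
    ultimately have "lam * ?S + (1 - lam / l) / (2 * D) * ?Q \<le> ?W / 2" using 1 by linarith
    also have "\<dots> = (\<Sum>c\<in>Cs. gain q cs c)" using gain_eq_cap_weight[OF g ch] by simp
    finally show "lam * ?S + (1 - lam / l) / (2 * D) * ?Q \<le> (\<Sum>c\<in>Cs. gain q cs c)" .
  qed
qed

lemma source_in_reach: "source N c \<in> reach c"
  by (simp add: reach_def)

lemma raw_sink: "c \<in> {Raw1, Raw2} \<Longrightarrow> sink N c = comp_node N"
  by auto

section \<open>One slot started from a consistent state\<close>

context
  fixes T B X
  assumes good: "consistent T B X"
begin

lemma tags_subset: "k \<in> nodes N \<Longrightarrow> B c k \<subseteq> T" "c \<in> {Raw1, Raw2} \<Longrightarrow> X c \<subseteq> T"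
  using good by (auto simp: consistent_def)

lemma finite_queue: "k \<in> nodes N \<Longrightarrow> finite (B c k)"
  by (rule finite_subset[OF tags_subset(1)]) (use good in \<open>simp_all add: consistent_def\<close>)

lemma empty_queue: "k \<in> nodes N \<Longrightarrow> k \<notin> reach c \<or> k = sink N c \<Longrightarrow> B c k = {}"
  using good by (simp add: consistent_def)

lemma queue_disjoint:
  assumes "c \<in> {Raw1, Raw2}" "k \<in> nodes N"
  shows "j \<in> nodes N \<Longrightarrow> k \<noteq> j \<Longrightarrow> B c k \<inter> B c j = {}" "B c k \<inter> X c = {}"
proof -
  have "disjoint_family_on (B c) (nodes N)" "B c k \<inter> X c = {}"
    using assms good by (auto simp: consistent_def)
  with assms show "j \<in> nodes N \<Longrightarrow> k \<noteq> j \<Longrightarrow> B c k \<inter> B c j = {}" "B c k \<inter> X c = {}"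
    by (simp_all add: disjoint_family_on_def)
qed

lemma outstanding_subset: "c \<in> {Raw1, Raw2} \<Longrightarrow> outstanding B X c \<subseteq> T"
  unfolding outstanding_def by (intro Un_least UN_least tags_subset)

lemma finite_outstanding: "c \<in> {Raw1, Raw2} \<Longrightarrow> finite (outstanding B X c)"
  by (rule finite_subset[OF outstanding_subset]) (use good in \<open>simp_all add: consistent_def\<close>)

text \<open>Both raw classes have the same outstanding tags, so a tag that does not wait as a
  complete pair still has one of its two packets in a queue.\<close>

lemma card_outstanding_le:
  "real (card (outstanding B X Raw1)) \<le> real (card (X Raw1 \<inter> X Raw2)) + backlog {Raw1, Raw2} B"
proof -
  let ?W = "\<lambda>c. \<Union>k\<in>nodes N. B c k"
  have sub: "outstanding B X Raw1 \<subseteq> (X Raw1 \<inter> X Raw2) \<union> ?W Raw1 \<union> ?W Raw2"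
    using good by (auto simp: outstanding_def consistent_def)
  have fin: "finite (X Raw1 \<inter> X Raw2)" "finite (?W c)" for c
    using finite_queue finite_outstanding[of Raw1] by (auto simp: outstanding_def)
  have "card (outstanding B X Raw1) \<le> card ((X Raw1 \<inter> X Raw2) \<union> ?W Raw1 \<union> ?W Raw2)"
    using fin sub by (intro card_mono) auto
  also have "\<dots> \<le> card (X Raw1 \<inter> X Raw2) + card (?W Raw1) + card (?W Raw2)"
    by (meson add_le_mono card_Un_le le_refl order_trans)
  also have "\<dots> \<le> card (X Raw1 \<inter> X Raw2) + (\<Sum>k\<in>nodes N. card (B Raw1 k)) + (\<Sum>k\<in>nodes N. card (B Raw2 k))"
    by (intro add_mono card_UN_le order_refl finite_nodes)
  finally have "real (card (outstanding B X Raw1)) \<le>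
     real (card (X Raw1 \<inter> X Raw2) + (\<Sum>k\<in>nodes N. card (B Raw1 k)) + (\<Sum>k\<in>nodes N. card (B Raw2 k)))"
    by (rule of_nat_mono)
  then show ?thesis by (simp add: backlog_def)
qed

context
  fixes new B' X' cs mv K
  assumes slot: "slot_by N (carried E1 E2) new B X B' X' cs mv K"
    and new: "finite new" "new \<inter> T = {}"
begin

private abbreviation "Q \<equiv> \<lambda>c k. card (B c k)"
private abbreviation "U \<equiv> bp_service N Q cs"
private abbreviation "a \<equiv> \<lambda>c. card (if c = Processed then K else new)"

lemma choice: "bp_choice N (carried E1 E2) Q cs"
  using slot by (simp add: slot_by_def)

lemma moves:
  assumes "m \<in> nodes N"
  shows "k \<in> nodes N \<Longrightarrow> mv c m k \<subseteq> B c m" "k \<in> nodes N \<Longrightarrow> card (mv c m k) \<le> U c m k"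
    "disjoint_family_on (mv c m) (nodes N)"
    "(\<Sum>k\<in>nodes N. card (mv c m k)) = min (Q c m) (\<Sum>k\<in>nodes N. U c m k)"
proof -
  have "bp_moves N U B mv" using slot by (simp add: slot_by_def)
  with assms show "k \<in> nodes N \<Longrightarrow> mv c m k \<subseteq> B c m" "k \<in> nodes N \<Longrightarrow> card (mv c m k) \<le> U c m k"
    "disjoint_family_on (mv c m) (nodes N)"
    "(\<Sum>k\<in>nodes N. card (mv c m k)) = min (Q c m) (\<Sum>k\<in>nodes N. U c m k)"
    by (simp_all add: bp_moves_def)
qed

lemma combined: "K \<subseteq> X Raw1" "K \<subseteq> X Raw2" "card K = min (card (X Raw1 \<inter> X Raw2)) (comp_cap N)"
  using slot by (simp_all add: slot_by_def)

lemma next_queue: "k \<in> nodes N \<Longrightarrow> B' c k = (if k = sink N c then {}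
         else (B c k - (\<Union>j\<in>nodes N. mv c k j)) \<union> (\<Union>j\<in>nodes N. mv c j k) \<union>
           (if k = source N c then (if c = Processed then K else new) else {}))"
  using slot by (simp add: slot_by_def)

lemma next_buffer: "c \<in> {Raw1, Raw2} \<Longrightarrow> X' c =
        (X c - K) \<union> (\<Union>j\<in>nodes N. mv c j (comp_node N)) \<union>
          (if source N c = comp_node N then new else {})"
  using slot unfolding slot_by_def by blast

text \<open>A link that moves a packet was allocated positive service, hence is usable for the
  class, and the sending queue was non-empty, hence at a reachable node.\<close>

lemma move_reach:
  assumes "m \<in> nodes N" "k \<in> nodes N" "q \<in> mv c m k"
  shows "k \<in> reach c"
proof -
  have "finite (mv c m k)" using moves(1)[OF assms(1,2)] finite_queue[OF assms(1)]
    by (rule finite_subset)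
  with assms(3) have "card (mv c m k) > 0" by (auto simp: card_gt_0_iff)
  with moves(2)[OF assms(1,2)] have "U c m k > 0" by (meson less_le_trans)
  then have e: "{m, k} \<in> edges N" "c = cs {m, k}" "cap N {m, k} > 0"
    by (auto simp: bp_service_def split: if_splits)
  with choice have "c \<in> carried E1 E2 {m, k}" by (auto simp: bp_choice_def)
  then have "(m, k) \<in> links c" using e by (auto simp: in_carried_iff links_def)
  moreover have "m \<in> reach c"
    using assms moves(1)[of m k c] empty_queue[of m c] by blast
  ultimately show ?thesis by (auto simp: reach_def intro: rtrancl.rtrancl_into_rtrancl)
qed

lemma next_queue_subset:
  assumes "k \<in> nodes N"
  shows "B' c k \<subseteq> (\<Union>j\<in>nodes N. B c j) \<union> (if c = Processed then K else new)"
proof -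
  have "(\<Union>j\<in>nodes N. mv c j k) \<subseteq> (\<Union>j\<in>nodes N. B c j)"
    by (intro UN_mono order_refl moves(1) assms)
  moreover have "B c k \<subseteq> (\<Union>j\<in>nodes N. B c j)" using assms by blast
  ultimately show ?thesis unfolding next_queue[OF assms, of c] by (simp split: if_split) blast
qed

text \<open>An old tag has a single home node, where it either stays or leaves along one link
  because the moves from a node are disjoint. A new tag is fresh and enters at the source
  only.\<close>

lemma next_queue_disjoint:
  assumes c: "c \<in> {Raw1, Raw2}" and k: "k \<in> nodes N" "j \<in> nodes N" "k \<noteq> j"
  shows "B' c k \<inter> B' c j = {}"
proof (rule ccontr)
  assume "B' c k \<inter> B' c j \<noteq> {}"
  then obtain q where q: "q \<in> B' c k" "q \<in> B' c j" by blast
  have cases: "(q \<in> B c i \<and> (\<forall>h\<in>nodes N. q \<notin> mv c i h)) \<or> (\<exists>h\<in>nodes N. q \<in> mv c h i) \<or>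
      (i = source N c \<and> q \<in> new)" if "q \<in> B' c i" "i \<in> nodes N" for i
    using that next_queue[of i c] c by (auto split: if_splits)
  have new_T: "q \<in> new \<Longrightarrow> i \<in> nodes N \<Longrightarrow> q \<notin> B c i" for i
    using new tags_subset(1)[of i c] by blast
  have new_mv: "q \<in> new \<Longrightarrow> i \<in> nodes N \<Longrightarrow> h \<in> nodes N \<Longrightarrow> q \<notin> mv c i h" for i h
    using new_T[of i] moves(1)[of i h c] by blast
  have one: "i = h" if "q \<in> B c i" "q \<in> B c h" "i \<in> nodes N" "h \<in> nodes N" for i h
    using queue_disjoint(1)[OF c, of i h] that by blast
  have mv_B: "q \<in> mv c i h \<Longrightarrow> i \<in> nodes N \<Longrightarrow> h \<in> nodes N \<Longrightarrow> q \<in> B c i" for i h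
    using moves(1)[of i h c] by blast
  have one': "k = j" if "h \<in> nodes N" "q \<in> mv c h k" "q \<in> mv c h j" for h
    using moves(3)[OF that(1), of c] that k by (auto simp: disjoint_family_on_def)
  show False
  proof (cases "q \<in> new")
    case True
    then have "k = source N c" "j = source N c"
      using cases[OF q(1) k(1)] cases[OF q(2) k(2)] new_T new_mv k by blast+
    with k show False by simp
  next
    case False
    obtain h where h: "h \<in> nodes N" "q \<in> B c h"
      using cases[OF q(1) k(1)] False mv_B k by blast
    then have home: "i \<in> nodes N \<Longrightarrow> q \<in> B c i \<Longrightarrow> i = h" for i using one by blast
    have "q \<in> mv c h i \<or> (i = h \<and> (\<forall>g\<in>nodes N. q \<notin> mv c h g))" if "i \<in> nodes N" "q \<in> B' c i" for i
      using cases[OF that(2,1)] False home that mv_B by blast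
    from this[OF k(1) q(1)] this[OF k(2) q(2)] show False
      using one'[OF h(1)] k by blast
  qed
qed

text \<open>Moves only relocate packets, into another queue or, at the computation node, into the
  buffer. Only arrivals and combinations change the set; the combined tags lie in the buffer, which
  is disjoint from the queues, so they disappear completely.\<close>

lemma outstanding_step:
  assumes c: "c \<in> {Raw1, Raw2}"
  shows "outstanding B' X' c = (outstanding B X c - K) \<union> new"
proof -
  have K: "K \<subseteq> X c" using combined c by auto
  have KB: "q \<in> B c k \<Longrightarrow> k \<in> nodes N \<Longrightarrow> q \<notin> K" for q k
    using K queue_disjoint(2)[OF c, of k] by blast
  have mv_B: "q \<in> mv c i h \<Longrightarrow> i \<in> nodes N \<Longrightarrow> h \<in> nodes N \<Longrightarrow> q \<in> B c i" for q i h
    using moves(1)[of i h c] by blast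
  note X' = next_buffer[OF c] and sk = raw_sink[OF c]
  have B': "B' c k = (if k = comp_node N then {}
         else (B c k - (\<Union>j\<in>nodes N. mv c k j)) \<union> (\<Union>j\<in>nodes N. mv c j k) \<union>
           (if k = source N c then new else {}))" if "k \<in> nodes N" for k
    using next_queue[OF that, of c] c sk by auto
  show ?thesis
  proof (intro equalityI subsetI)
    fix q assume "q \<in> outstanding B' X' c"
    then consider "q \<in> X' c" | k where "k \<in> nodes N" "q \<in> B' c k" by (auto simp: outstanding_def)
    then show "q \<in> (outstanding B X c - K) \<union> new"
    proof cases
      case 1
      then consider "q \<in> X c - K" | h where "h \<in> nodes N" "q \<in> mv c h (comp_node N)" | "q \<in> new"
        unfolding X' by (auto split: if_splits)
      then show ?thesis
      proof cases
        case 2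
        with mv_B[of q h "comp_node N"] KB[of q h] show ?thesis by (auto simp: outstanding_def)
      qed (auto simp: outstanding_def)
    next
      case 2
      then consider "q \<in> B c k" | h where "h \<in> nodes N" "q \<in> mv c h k" | "q \<in> new"
        unfolding B'[OF 2(1)] by (auto split: if_splits)
      then show ?thesis
      proof cases
        case 1
        with 2(1) KB[of q k] show ?thesis by (auto simp: outstanding_def)
      next
        case (2 h)
        with \<open>k \<in> nodes N\<close> mv_B[of q h k] KB[of q h] show ?thesis by (auto simp: outstanding_def)
      qed auto
    qed
  next
    fix q assume "q \<in> (outstanding B X c - K) \<union> new"
    then consider "q \<in> new" | "q \<in> X c - K" | k where "k \<in> nodes N" "q \<in> B c k"
      by (auto simp: outstanding_def)
    then show "q \<in> outstanding B' X' c"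
    proof cases
      case 1
      then show ?thesis unfolding X' outstanding_def using B'[of "source N c"]
        by (cases "source N c = comp_node N") auto
    next
      case 2
      then show ?thesis unfolding X' outstanding_def by auto
    next
      case 3
      \<comment> \<open>The queue at the sink is always empty, so the clause that resets it in
        \<open>B'\<close> loses no packet that stays put.\<close>
      then have "k \<noteq> comp_node N" using empty_queue[of k c] sk by auto
      show ?thesis
      proof (cases "\<exists>j\<in>nodes N. q \<in> mv c k j")
        case True
        then obtain j where j: "j \<in> nodes N" "q \<in> mv c k j" by blast
        show ?thesis
        proof (cases "j = comp_node N")
          case True
          then show ?thesis unfolding X' outstanding_def using 3 j by auto
        next
          case False
          then have "q \<in> B' c j" using B'[OF j(1)] 3 j by auto
          then show ?thesis unfolding outstanding_def using j by auto
        qed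
      next
        case False
        then have "q \<in> B' c k" using B'[OF 3(1)] 3 \<open>k \<noteq> comp_node N\<close> by auto
        then show ?thesis unfolding outstanding_def using 3 by auto
      qed
    qed
  qed
qed

text \<open>The home-node argument again, with the buffer receiving the packets that are sent to the
  computation node.\<close>

lemma next_queue_buffer_disjoint:
  assumes c: "c \<in> {Raw1, Raw2}" and k: "k \<in> nodes N"
  shows "B' c k \<inter> X' c = {}"
proof (rule ccontr)
  assume "B' c k \<inter> X' c \<noteq> {}"
  then obtain q where q: "q \<in> B' c k" "q \<in> X' c" by blast
  note sk = raw_sink[OF c]
  have ks: "k \<noteq> comp_node N" using q(1) next_queue[OF k, of c] sk by auto
  have B: "(q \<in> B c k \<and> (\<forall>h\<in>nodes N. q \<notin> mv c k h)) \<or> (\<exists>h\<in>nodes N. q \<in> mv c h k) \<or>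
      (k = source N c \<and> q \<in> new)"
    using q(1) next_queue[OF k, of c] c by (auto split: if_splits)
  have X: "q \<in> X c \<or> (\<exists>h\<in>nodes N. q \<in> mv c h (comp_node N)) \<or> (source N c = comp_node N \<and> q \<in> new)"
    using q(2) next_buffer[OF c] by (auto split: if_splits)
  have new_T: "q \<in> new \<Longrightarrow> i \<in> nodes N \<Longrightarrow> q \<notin> B c i" for i
    using new tags_subset(1)[of i c] by blast
  have new_X: "q \<in> new \<Longrightarrow> q \<notin> X c"
    using new tags_subset(2)[OF c] by blast
  have BX: "q \<in> B c i \<Longrightarrow> i \<in> nodes N \<Longrightarrow> q \<notin> X c" for i
    using queue_disjoint(2)[OF c, of i] by blast
  have one: "i = h" if "q \<in> B c i" "q \<in> B c h" "i \<in> nodes N" "h \<in> nodes N" for i h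
    using queue_disjoint(1)[OF c, of i h] that by blast
  have mv_B: "q \<in> mv c i h \<Longrightarrow> i \<in> nodes N \<Longrightarrow> h \<in> nodes N \<Longrightarrow> q \<in> B c i" for i h
    using moves(1)[of i h c] by blast
  have one': "k = comp_node N" if "h \<in> nodes N" "q \<in> mv c h k" "q \<in> mv c h (comp_node N)" for h
    using moves(3)[OF that(1), of c] that k comp_in_nodes unfolding disjoint_family_on_def by blast
  show False
  proof (cases "q \<in> new")
    case True
    then have "k = source N c" "source N c = comp_node N"
      using B X new_T new_X mv_B k comp_in_nodes by blast+
    with ks show False by simp
  next
    case False
    obtain h where h: "h \<in> nodes N" "q \<in> B c h"
      using B False mv_B k by blast
    then have home: "i \<in> nodes N \<Longrightarrow> q \<in> B c i \<Longrightarrow> i = h" for i using one by blast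
    have "q \<in> mv c h (comp_node N)" using X False home BX[OF h(2,1)] mv_B comp_in_nodes by blast
    moreover have "q \<in> mv c h k \<or> (\<forall>g\<in>nodes N. q \<notin> mv c h g)"
      using B False home mv_B k by blast
    ultimately show False using one'[OF h(1)] ks by auto
  qed
qed

lemma consistent_step: "consistent (T \<union> new) B' X'"
  unfolding consistent_def
proof (intro conjI allI ballI impI)
  show "finite (T \<union> new)" using good new by (simp add: consistent_def)
next
  fix c k assume k: "k \<in> nodes N"
  have "K \<subseteq> T" using combined tags_subset(2)[of Raw1] by auto
  moreover have "(\<Union>j\<in>nodes N. B c j) \<subseteq> T" by (intro UN_least tags_subset(1))
  ultimately show "B' c k \<subseteq> T \<union> new" using next_queue_subset[OF k, of c]
    by (cases "c = Processed") (simp, blast)+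
  assume a: "k \<notin> reach c \<or> k = sink N c"
  show "B' c k = {}"
  proof (cases "k = sink N c")
    case True
    then show ?thesis using next_queue[OF k, of c] by simp
  next
    case False
    with a have "k \<notin> reach c" by simp
    moreover from this have "k \<noteq> source N c" using source_in_reach[of c] by auto
    ultimately show ?thesis using next_queue[OF k, of c] empty_queue[OF k, of c] move_reach[OF _ k, of _ _ c]
      by auto
  qed
next
  fix c :: data_class assume c: "c \<in> {Raw1, Raw2}"
  show "X' c \<subseteq> T \<union> new"
  proof -
    have "(\<Union>j\<in>nodes N. mv c j (comp_node N)) \<subseteq> T"
      by (intro UN_least order_trans[OF moves(1) tags_subset(1)] comp_in_nodes)
    then show ?thesis unfolding next_buffer[OF c] using tags_subset(2)[OF c]
      by (simp split: if_split) blast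
  qed
  show "disjoint_family_on (B' c) (nodes N)"
    using next_queue_disjoint[OF c] by (auto simp: disjoint_family_on_def)
  show "\<And>k. k \<in> nodes N \<Longrightarrow> B' c k \<inter> X' c = {}"
    by (rule next_queue_buffer_disjoint[OF c])
next
  \<comment> \<open>The same tags \<open>K\<close> leave and the same tags \<open>new\<close> enter
    for both raw classes.\<close>
  have "outstanding B X Raw1 = outstanding B X Raw2" using good by (simp add: consistent_def)
  then show "outstanding B' X' Raw1 = outstanding B' X' Raw2"
    by (simp add: outstanding_step)
qed

lemma card_outstanding_step:
  "real (card (outstanding B' X' Raw1)) = real (card (outstanding B X Raw1)) + real (card new) - real (card K)"
proof -
  have K: "K \<subseteq> outstanding B X Raw1" using combined by (auto simp: outstanding_def)
  have fin: "finite (outstanding B X Raw1)" by (simp add: finite_outstanding)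
  have "outstanding B X Raw1 \<subseteq> T" by (simp add: outstanding_subset)
  then have "(outstanding B X Raw1 - K) \<inter> new = {}" using new by blast
  then have "card (outstanding B' X' Raw1) = card (outstanding B X Raw1 - K) + card new"
    using fin new by (simp add: outstanding_step card_Un_disjoint)
  moreover have "card (outstanding B X Raw1 - K) = card (outstanding B X Raw1) - card K"
    by (rule card_Diff_subset[OF finite_subset[OF K fin] K])
  moreover have "card K \<le> card (outstanding B X Raw1)" using K fin by (rule card_mono[rotated])
  ultimately show ?thesis by simp
qed

text \<open>Departures are exactly the minimum of backlog and allocated service, which gives the
  truncated difference. Packets received may fall short of the service allocated on incoming links,
  so only an upper bound results.\<close>

lemma card_next_queue:
  assumes k: "k \<in> nodes N"
  shows "card (B' c k) \<le> Q c k - (\<Sum>j\<in>nodes N. U c k j) +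
    ((\<Sum>j\<in>nodes N. U c j k) + (if k = source N c then card (if c = Processed then K else new) else 0))"
proof (cases "k = sink N c")
  case True
  then show ?thesis using next_queue[OF k, of c] by simp
next
  case False
  let ?out = "\<Union>j\<in>nodes N. mv c k j" and ?in = "\<Union>j\<in>nodes N. mv c j k"
    and ?new = "if k = source N c then (if c = Processed then K else new) else {}"
  have fin: "finite (mv c m j)" if "m \<in> nodes N" "j \<in> nodes N" for m j
    using moves(1)[OF that] finite_queue[OF that(1)] by (rule finite_subset)
  have "card ?out = (\<Sum>j\<in>nodes N. card (mv c k j))"
    using moves(3)[OF k] fin[OF k] by (intro card_UN_disjoint) (auto simp: disjoint_family_on_def)
  then have out: "card ?out = min (Q c k) (\<Sum>j\<in>nodes N. U c k j)" using moves(4)[OF k] by simp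
  have "?out \<subseteq> B c k" using moves(1)[OF k] by blast
  then have "card (B c k - ?out) = Q c k - card ?out"
    by (intro card_Diff_subset finite_subset[OF _ finite_queue[OF k]])
  then have 1: "card (B c k - ?out) = Q c k - (\<Sum>j\<in>nodes N. U c k j)" using out by simp
  have "card ?in \<le> (\<Sum>j\<in>nodes N. card (mv c j k))" by (rule card_UN_le) simp
  also have "\<dots> \<le> (\<Sum>j\<in>nodes N. U c j k)" using moves(2) k by (intro sum_mono) auto
  finally have 2: "card ?in \<le> (\<Sum>j\<in>nodes N. U c j k)" .
  have "card (B' c k) = card ((B c k - ?out) \<union> ?in \<union> ?new)" using next_queue[OF k, of c] False by simp
  also have "\<dots> \<le> card (B c k - ?out) + card ?in + card ?new"
    by (meson add_le_mono card_Un_le le_refl order_trans)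
  finally show ?thesis using 1 2 by auto
qed

lemma service_le_total_cap:
  assumes "k \<in> nodes N"
  shows "real (\<Sum>j\<in>nodes N. U c k j) \<le> total_cap" "real (\<Sum>j\<in>nodes N. U c j k) \<le> total_cap"
proof -
  have "(\<Sum>j\<in>nodes N. real (U c k j)) \<le> (\<Sum>j\<in>nodes N. real (cap N {k, j}))"
    by (intro sum_mono) (simp add: bp_service_def)
  also have "\<dots> \<le> total_cap" unfolding total_cap_def
    using assms by (intro member_le_sum[where f = "\<lambda>m. \<Sum>k\<in>nodes N. real (cap N {m, k})"]) (auto intro: sum_nonneg)
  finally show "real (\<Sum>j\<in>nodes N. U c k j) \<le> total_cap" by simp
  have "(\<Sum>j\<in>nodes N. real (U c j k)) \<le> (\<Sum>j\<in>nodes N. real (cap N {k, j}))"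
    by (intro sum_mono) (simp add: bp_service_def insert_commute)
  also have "\<dots> \<le> total_cap" unfolding total_cap_def
    using assms by (intro member_le_sum[where f = "\<lambda>m. \<Sum>k\<in>nodes N. real (cap N {m, k})"]) (auto intro: sum_nonneg)
  finally show "real (\<Sum>j\<in>nodes N. U c j k) \<le> total_cap" by simp
qed

text \<open>\<open>square_step\<close> summed over the nodes. Outgoing service contributes one
  square of \<open>total_cap\<close>; incoming service and arrivals contribute two more and twice
  the squared arrivals, by \<open>(v + a)^2 \<le> 2 * v^2 + 2 * a^2\<close>. The squared arrivals
  are charged at every node, hence the common factor.\<close>

lemma class_drift:
  "(\<Sum>k\<in>nodes N. (real (card (B' c k)))\<^sup>2) \<le> (\<Sum>k\<in>nodes N. (real (Q c k))\<^sup>2)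
    + real (card (nodes N)) * (3 * total_cap\<^sup>2 + 2 * (real (a c))\<^sup>2)
    + 2 * real (a c) * real (Q c (source N c)) - 2 * gain Q cs c"
proof -
  let ?u = "\<lambda>k. \<Sum>j\<in>nodes N. U c k j" and ?v = "\<lambda>k. \<Sum>j\<in>nodes N. U c j k"
    and ?a = "\<lambda>k. if k = source N c then a c else 0" and ?x = "\<lambda>k. real (Q c k)"
  have "(\<Sum>k\<in>nodes N. (real (card (B' c k)))\<^sup>2) \<le> (\<Sum>k\<in>nodes N. (?x k)\<^sup>2 +
      (3 * total_cap\<^sup>2 + 2 * (real (a c))\<^sup>2) + 2 * ?x k * real (?a k) + 2 * (?x k * real (?v k) - ?x k * real (?u k)))"
  proof (rule sum_mono)
    fix k assume k: "k \<in> nodes N"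
    have "(real (card (B' c k)))\<^sup>2 \<le> (?x k)\<^sup>2 + (real (?u k))\<^sup>2 + (real (?v k + ?a k))\<^sup>2
        + 2 * ?x k * (real (?v k + ?a k) - real (?u k))"
      by (rule square_step[OF card_next_queue[OF k]])
    moreover have "(real (?u k))\<^sup>2 \<le> total_cap\<^sup>2"
      using service_le_total_cap(1)[OF k] by (intro power_mono) (simp_all add: sum_nonneg)
    moreover have "(real (?v k + ?a k))\<^sup>2 \<le> 2 * total_cap\<^sup>2 + 2 * (real (a c))\<^sup>2"
    proof -
      have v: "(real (?v k))\<^sup>2 \<le> total_cap\<^sup>2"
        using service_le_total_cap(2)[OF k] by (intro power_mono) (simp_all add: sum_nonneg)
      have a: "(real (?a k))\<^sup>2 \<le> (real (a c))\<^sup>2" by simp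
      have "(real (?v k) + real (?a k))\<^sup>2 \<le> 2 * (real (?v k))\<^sup>2 + 2 * (real (?a k))\<^sup>2"
        using sum_squares_bound[of "real (?v k)" "real (?a k)"] by (simp only: power2_sum)
      with v a show ?thesis by (simp only: of_nat_add)
    qed
    moreover have "2 * ?x k * (real (?v k + ?a k) - real (?u k)) =
      2 * ?x k * real (?a k) + 2 * (?x k * real (?v k) - ?x k * real (?u k))"
      by (simp only: of_nat_add ring_distribs)
    ultimately show "(real (card (B' c k)))\<^sup>2 \<le> (?x k)\<^sup>2 +
      (3 * total_cap\<^sup>2 + 2 * (real (a c))\<^sup>2) + 2 * ?x k * real (?a k) + 2 * (?x k * real (?v k) - ?x k * real (?u k))"
      by linarith
  qed
  also have "\<dots> = (\<Sum>k\<in>nodes N. (?x k)\<^sup>2) + real (card (nodes N)) * (3 * total_cap\<^sup>2 + 2 * (real (a c))\<^sup>2)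
      + (\<Sum>k\<in>nodes N. 2 * ?x k * real (?a k))
      + 2 * ((\<Sum>k\<in>nodes N. ?x k * real (?v k)) - (\<Sum>k\<in>nodes N. ?x k * real (?u k)))"
    by (simp only: sum.distrib sum_distrib_left[symmetric] sum_subtractf sum_constant) (simp add: algebra_simps)
  also have "(\<Sum>k\<in>nodes N. 2 * ?x k * real (?a k)) = (\<Sum>k\<in>nodes N. if k = source N c then 2 * ?x k * real (a c) else 0)"
    by (intro sum.cong) auto
  also have "\<dots> = 2 * real (a c) * ?x (source N c)"
    by simp
  \<comment> \<open>Regrouping by links: each unit of service counts negatively with the queue it
    leaves and positively with the one it enters.\<close>
  also have "(\<Sum>k\<in>nodes N. ?x k * real (?v k)) - (\<Sum>k\<in>nodes N. ?x k * real (?u k)) = - gain Q cs c"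
  proof -
    have "(\<Sum>k\<in>nodes N. ?x k * real (?v k)) = (\<Sum>k\<in>nodes N. \<Sum>j\<in>nodes N. real (U c j k) * ?x k)"
      by (simp add: sum_distrib_left mult.commute)
    also have "\<dots> = (\<Sum>j\<in>nodes N. \<Sum>k\<in>nodes N. real (U c j k) * ?x k)" by (rule sum.swap)
    finally show ?thesis
      by (simp add: gain_def right_diff_distrib sum_subtractf sum_distrib_left algebra_simps)
  qed
  finally show ?thesis by simp
qed

lemma queue_growth:
  assumes k: "k \<in> nodes N"
  shows "real (card (B' c k)) \<le> real (Q c k) + total_cap + real (a c)"
proof -
  have "real (card (B' c k)) \<le> real (Q c k + ((\<Sum>j\<in>nodes N. U c j k) + a c))"
    using card_next_queue[OF k, of c] by (intro of_nat_mono) (auto split: if_splits)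
  then show ?thesis using service_le_total_cap(2)[OF k, of c] by (simp only: of_nat_add)
qed

end

end

text \<open>Adds up \<open>class_drift\<close> over the group and inserts
  \<open>backpressure_gain\<close>. The constant is obtained before the state is fixed, so it is
  uniform over all states.\<close>

lemma group_drift:
  assumes f: "supports N l f" "lam < l" "0 \<le> lam" and g: "class_group Cs E"
  obtains \<epsilon> where "\<epsilon> > 0" "\<And>T new B X B' X' cs mv K.
    consistent T B X \<Longrightarrow> slot_by N (carried E1 E2) new B X B' X' cs mv K \<Longrightarrow> finite new \<Longrightarrow> new \<inter> T = {} \<Longrightarrow>
    backlog_sq Cs B' \<le> backlog_sq Cs B
      + (\<Sum>c\<in>Cs. real (card (nodes N)) * (3 * total_cap\<^sup>2 + 2 * (real (card (if c = Processed then K else new)))\<^sup>2))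
      + 2 * (\<Sum>c\<in>Cs. (real (card (if c = Processed then K else new)) - lam) * real (card (B c (source N c))))
      - \<epsilon> * backlog Cs B"
proof -
  obtain \<epsilon> where e: "\<epsilon> > 0" "\<And>q cs. bp_choice N (carried E1 E2) q cs \<Longrightarrow>
    (\<And>c k. c \<in> Cs \<Longrightarrow> k \<in> nodes N \<Longrightarrow> k \<notin> reach c \<or> k = sink N c \<Longrightarrow> q c k = 0) \<Longrightarrow>
    lam * (\<Sum>c\<in>Cs. real (q c (source N c))) + \<epsilon> * (\<Sum>c\<in>Cs. \<Sum>k\<in>nodes N. real (q c k))
      \<le> (\<Sum>c\<in>Cs. gain q cs c)"
    using backpressure_gain[OF f g] by blast
  show ?thesis
  proof
    \<comment> \<open>The gain enters the drift of the squares with the factor 2.\<close>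
    show "2 * \<epsilon> > 0" using e by simp
  next
    fix T new B X B' X' cs mv K
    assume good: "consistent T B X" and slot: "slot_by N (carried E1 E2) new B X B' X' cs mv K"
      and new: "finite new" "new \<inter> T = {}"
    let ?q = "\<lambda>c k. card (B c k)" and ?a = "\<lambda>c. real (card (if c = Processed then K else new))"
    have gain: "lam * (\<Sum>c\<in>Cs. real (?q c (source N c))) + \<epsilon> * backlog Cs B \<le> (\<Sum>c\<in>Cs. gain ?q cs c)"
      unfolding backlog_def
      by (intro e(2) choice[OF good slot new]) (simp add: empty_queue[OF good])
    have "backlog_sq Cs B' \<le> (\<Sum>c\<in>Cs. (\<Sum>k\<in>nodes N. (real (?q c k))\<^sup>2)
        + real (card (nodes N)) * (3 * total_cap\<^sup>2 + 2 * (?a c)\<^sup>2)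
        + 2 * (?a c * real (?q c (source N c))) - 2 * gain ?q cs c)"
      unfolding backlog_sq_def
      using class_drift[OF good slot new] by (intro sum_mono) (simp only: mult.assoc)
    also have "\<dots> = backlog_sq Cs B + (\<Sum>c\<in>Cs. real (card (nodes N)) * (3 * total_cap\<^sup>2 + 2 * (?a c)\<^sup>2))
        + 2 * (\<Sum>c\<in>Cs. ?a c * real (?q c (source N c))) - 2 * (\<Sum>c\<in>Cs. gain ?q cs c)"
      unfolding backlog_sq_def
      by (simp only: sum.distrib sum_subtractf sum_distrib_left[symmetric])
    also have "\<dots> \<le> backlog_sq Cs B + (\<Sum>c\<in>Cs. real (card (nodes N)) * (3 * total_cap\<^sup>2 + 2 * (?a c)\<^sup>2))
        + 2 * (\<Sum>c\<in>Cs. ?a c * real (?q c (source N c)))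
        - 2 * (lam * (\<Sum>c\<in>Cs. real (?q c (source N c))) + \<epsilon> * backlog Cs B)"
      using gain by simp
    also have "(\<Sum>c\<in>Cs. ?a c * real (?q c (source N c))) = (\<Sum>c\<in>Cs. (?a c - lam) * real (?q c (source N c)))
        + lam * (\<Sum>c\<in>Cs. real (?q c (source N c)))"
      by (simp add: left_diff_distrib sum_subtractf sum_distrib_left)
    finally show "backlog_sq Cs B' \<le> backlog_sq Cs B
      + (\<Sum>c\<in>Cs. real (card (nodes N)) * (3 * total_cap\<^sup>2 + 2 * (?a c)\<^sup>2))
      + 2 * (\<Sum>c\<in>Cs. (?a c - lam) * real (?q c (source N c)))
      - 2 * \<epsilon> * backlog Cs B" by (simp add: algebra_simps)
  qed
qed

end

section \<open>Joint drift of raw queues, pending queries and processed queues\<close>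

context split_network
begin

definition pending :: "(data_class \<Rightarrow> 'v \<Rightarrow> tag set) \<Rightarrow> (data_class \<Rightarrow> tag set) \<Rightarrow> real" where
  "pending B X = real (card (outstanding B X Raw1))"

definition processed_at_comp :: "(data_class \<Rightarrow> 'v \<Rightarrow> tag set) \<Rightarrow> real" where
  "processed_at_comp B = real (card (B Processed (comp_node N)))"

text \<open>The completions that feed the processed network are bursty. The cross term turns them into the
  arrivals of queries, up to the bounded change of the queue at the computation node.\<close>

definition processed_potential ::
  "(data_class \<Rightarrow> 'v \<Rightarrow> tag set) \<Rightarrow> (data_class \<Rightarrow> tag set) \<Rightarrow> real" where
  "processed_potential B X = backlog_sq {Processed} B + 2 * processed_at_comp B * pending B X"

definition raw_at_sources :: "(data_class \<Rightarrow> 'v \<Rightarrow> tag set) \<Rightarrow> real" where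
  "raw_at_sources B = (\<Sum>c\<in>{Raw1, Raw2}. real (card (B c (source N c))))"

lemma affine_le_square:
  fixes b c d x :: real
  assumes "c \<le> b" "d \<le> b"
  shows "c + d * x\<^sup>2 \<le> b * (1 + x\<^sup>2)"
  using assms mult_right_mono[of d b "x\<^sup>2"] by (simp add: distrib_left)

lemma pending_drift:
  assumes good: "consistent T B X" and slot: "slot_by N (carried E1 E2) new B X B' X' cs mv K"
    and new: "finite new" "new \<inter> T = {}"
  defines "a \<equiv> real (card new)" and "C \<equiv> real (comp_cap N)"
  shows "(pending B' X')\<^sup>2 \<le> (pending B X)\<^sup>2 + 3 * C\<^sup>2 + a\<^sup>2 + 2 * (a - C) * pending B X
    + 2 * C * backlog {Raw1, Raw2} B"
proof -
  let ?Z = "pending B X" and ?G = "backlog {Raw1, Raw2} B" and ?k = "real (card K)"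
  have Z': "pending B' X' = ?Z + a - ?k"
    using card_outstanding_step[OF good slot new] by (simp add: pending_def a_def)
  have k: "card K = min (card (X Raw1 \<inter> X Raw2)) (comp_cap N)" by (rule combined(3)[OF good slot new])
  have Z0: "?Z \<ge> 0" and a0: "a \<ge> 0" and k0: "?k \<ge> 0" and kC: "?k \<le> C" and C0: "C \<ge> 0"
    using k by (auto simp: pending_def a_def C_def)
  have G0: "?G \<ge> 0" unfolding backlog_def by (intro sum_nonneg) simp
  \<comment> \<open>The loss from idle computing capacity. Capacity is idle only when every waiting
    pair is combined; there are then fewer than \<open>C\<close> pairs, so the pending queries
    number at most \<open>C\<close> plus the raw backlog.\<close>
  have "(C - ?k) * ?Z \<le> C * (C + ?G)"
  proof (cases "comp_cap N \<le> card (X Raw1 \<inter> X Raw2)")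
    case True
    then have "?k = C" using k by (simp add: C_def)
    then show ?thesis using C0 G0 by simp
  next
    case False
    then have "?k = real (card (X Raw1 \<inter> X Raw2))" using k by simp
    then have "?Z \<le> C + ?G" using card_outstanding_le[OF good] kC by (simp add: pending_def)
    then show ?thesis using k0 kC Z0 C0 by (intro mult_mono) auto
  qed
  moreover have "(a - ?k)\<^sup>2 \<le> a\<^sup>2 + C\<^sup>2"
  proof -
    have "(a - ?k)\<^sup>2 \<le> a\<^sup>2 + ?k\<^sup>2" using a0 k0 by (simp add: power2_diff)
    moreover have "?k\<^sup>2 \<le> C\<^sup>2" using k0 kC by (intro power_mono)
    ultimately show ?thesis by linarith
  qed
  moreover have "(pending B' X')\<^sup>2 = ?Z\<^sup>2 + 2 * (a - C) * ?Z + 2 * ((C - ?k) * ?Z) + (a - ?k)\<^sup>2"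
    unfolding Z' by (simp add: power2_eq_square algebra_simps)
  ultimately show ?thesis by (simp add: algebra_simps power2_eq_square)
qed

text \<open>The three inequalities form a cascade: the positive term of the second is the raw
  backlog controlled by the first, and that of the third is the number of pending queries controlled
  by the second. The terms with \<open>a - lam\<close> have mean zero.\<close>

definition drift_bound where
  "drift_bound lam \<epsilon> b a B X B' X' \<longleftrightarrow>
    backlog_sq {Raw1, Raw2} B' \<le> backlog_sq {Raw1, Raw2} B + b * (1 + a\<^sup>2)
      + 2 * (a - lam) * raw_at_sources B - \<epsilon> * backlog {Raw1, Raw2} B \<and>
    (pending B' X')\<^sup>2 \<le> (pending B X)\<^sup>2 + b * (1 + a\<^sup>2)
      + 2 * (a - lam) * pending B X + b * backlog {Raw1, Raw2} B - \<epsilon> * pending B X \<and>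
    processed_potential B' X' \<le> processed_potential B X + b * (1 + a\<^sup>2)
      + 2 * (a - lam) * processed_at_comp B + b * pending B X - \<epsilon> * backlog {Processed} B"

lemma slot_drift:
  assumes lam: "lam < lambda_star N" "0 \<le> lam"
  obtains \<epsilon> b where "\<epsilon> > 0" "b \<ge> 0" "\<And>T new B X B' X' cs mv K.
    consistent T B X \<Longrightarrow> slot_by N (carried E1 E2) new B X B' X' cs mv K \<Longrightarrow> finite new \<Longrightarrow> new \<inter> T = {} \<Longrightarrow>
    drift_bound lam \<epsilon> b (real (card new)) B X B' X'"
proof -
  obtain l f where f: "lam < l" "l \<le> real (comp_cap N)" "supports N l f"
    by (rule lambda_star_flow[OF lam])
  let ?n = "real (card (nodes N))" and ?C = "real (comp_cap N)"
  obtain e1 where e1: "e1 > 0" and d1: "\<And>T new B X B' X' cs mv K.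
    consistent T B X \<Longrightarrow> slot_by N (carried E1 E2) new B X B' X' cs mv K \<Longrightarrow> finite new \<Longrightarrow> new \<inter> T = {} \<Longrightarrow>
    backlog_sq {Raw1, Raw2} B' \<le> backlog_sq {Raw1, Raw2} B
      + (\<Sum>c\<in>{Raw1, Raw2}. ?n * (3 * total_cap\<^sup>2 + 2 * (real (card (if c = Processed then K else new)))\<^sup>2))
      + 2 * (\<Sum>c\<in>{Raw1, Raw2}. (real (card (if c = Processed then K else new)) - lam) * real (card (B c (source N c))))
      - e1 * backlog {Raw1, Raw2} B"
    using group_drift[OF f(3,1) lam(2) raw_group] by blast
  obtain e3 where e3: "e3 > 0" and d3: "\<And>T new B X B' X' cs mv K.
    consistent T B X \<Longrightarrow> slot_by N (carried E1 E2) new B X B' X' cs mv K \<Longrightarrow> finite new \<Longrightarrow> new \<inter> T = {} \<Longrightarrow>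
    backlog_sq {Processed} B' \<le> backlog_sq {Processed} B
      + (\<Sum>c\<in>{Processed}. ?n * (3 * total_cap\<^sup>2 + 2 * (real (card (if c = Processed then K else new)))\<^sup>2))
      + 2 * (\<Sum>c\<in>{Processed}. (real (card (if c = Processed then K else new)) - lam) * real (card (B c (source N c))))
      - e3 * backlog {Processed} B"
    using group_drift[OF f(3,1) lam(2) processed_group] by blast
  \<comment> \<open>The third entry is the slack of the computation node:
    \<open>pending_drift\<close> has \<open>a - C\<close> where \<open>a - lam\<close> is wanted,
    and \<open>lam < l \<le> C\<close> makes the difference strictly favourable.\<close>
  define \<epsilon> where "\<epsilon> = min (min e1 e3) (2 * (?C - lam))"
  \<comment> \<open>One constant per inequality, each dominating the coefficients there of 1, of the
    squared arrivals and of the quantity passed down the cascade; their sum serves all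
    three.\<close>
  define b1 b2 b3 where "b1 = 6 * (?n * total_cap\<^sup>2) + 4 * ?n" and "b2 = 3 * ?C\<^sup>2 + 2 * ?C + 1"
    and "b3 = 3 * (?n * total_cap\<^sup>2) + 2 * (?n * ?C\<^sup>2) + 2 * (total_cap + ?C)"
  note R0 = total_cap_nonneg
  have bs: "b1 \<ge> 0" "b2 \<ge> 0" "b3 \<ge> 0"
    using R0 by (simp_all add: b1_def b2_def b3_def)
  define b where "b = b1 + b2 + b3"
  have e: "\<epsilon> \<le> e1" "\<epsilon> \<le> e3" "\<epsilon> \<le> 2 * (?C - lam)" by (simp_all add: \<epsilon>_def)
  show ?thesis
  proof (rule that[of \<epsilon> b])
    show "\<epsilon> > 0" using e1 e3 f by (simp add: \<epsilon>_def)
    show "b \<ge> 0" using bs by (simp add: b_def)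
  next
    fix T new B X B' X' cs mv K
    assume h: "consistent T B X" "slot_by N (carried E1 E2) new B X B' X' cs mv K" "finite new" "new \<inter> T = {}"
    let ?a = "real (card new)" and ?k = "real (card K)" and ?Z = "pending B X" and ?q = "processed_at_comp B"
      and ?G = "backlog {Raw1, Raw2} B" and ?H = "backlog {Processed} B"
    have nn: "?Z \<ge> 0" "?G \<ge> 0" "?H \<ge> 0" "?q \<ge> 0" "?a \<ge> 0" "?k \<ge> 0" "?n \<ge> 0"
      by (simp_all add: pending_def backlog_def processed_at_comp_def sum_nonneg add_nonneg_nonneg)
    have kC: "?k \<le> ?C" using combined(3)[OF h] by simp
    have "6 * (?n * total_cap\<^sup>2) + 4 * ?n * ?a\<^sup>2 \<le> b * (1 + ?a\<^sup>2)"
      using bs R0 nn by (intro affine_le_square) (simp_all add: b_def b1_def)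
    moreover have "\<epsilon> * ?G \<le> e1 * ?G" using e nn by (intro mult_right_mono)
    moreover have "backlog_sq {Raw1, Raw2} B' \<le> backlog_sq {Raw1, Raw2} B
      + (6 * (?n * total_cap\<^sup>2) + 4 * ?n * ?a\<^sup>2) + 2 * (?a - lam) * raw_at_sources B - e1 * ?G"
      using d1[OF h] by (simp add: raw_at_sources_def algebra_simps)
    ultimately have 1: "backlog_sq {Raw1, Raw2} B' \<le> backlog_sq {Raw1, Raw2} B + b * (1 + ?a\<^sup>2)
      + 2 * (?a - lam) * raw_at_sources B - \<epsilon> * ?G" by linarith
    have "3 * ?C\<^sup>2 + 1 * ?a\<^sup>2 \<le> b * (1 + ?a\<^sup>2)"
      using bs by (intro affine_le_square) (simp_all add: b_def b2_def)
    moreover have "\<epsilon> * ?Z \<le> 2 * (?C - lam) * ?Z" using e nn by (intro mult_right_mono)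
    moreover have "2 * ?C * ?G \<le> b * ?G"
      using bs nn by (intro mult_right_mono) (simp_all add: b_def b2_def)
    moreover have "2 * (?a - ?C) * ?Z = 2 * (?a - lam) * ?Z - 2 * (?C - lam) * ?Z"
      by (simp add: algebra_simps)
    ultimately have 2: "(pending B' X')\<^sup>2 \<le> ?Z\<^sup>2 + b * (1 + ?a\<^sup>2) + 2 * (?a - lam) * ?Z + b * ?G - \<epsilon> * ?Z"
      using pending_drift[OF h] by linarith
    have V: "backlog_sq {Processed} B' \<le> backlog_sq {Processed} B
      + (3 * (?n * total_cap\<^sup>2) + 2 * (?n * ?k\<^sup>2)) + 2 * (?k - lam) * ?q - e3 * ?H"
      using d3[OF h] by (simp add: processed_at_comp_def algebra_simps)
    have k2: "2 * (?n * ?k\<^sup>2) \<le> 2 * (?n * ?C\<^sup>2)"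
      using kC nn by (intro mult_left_mono power_mono) simp_all
    have Z': "pending B' X' = ?Z + ?a - ?k"
      using card_outstanding_step[OF h] by (simp add: pending_def)
    have Z'0: "pending B' X' \<ge> 0" by (simp add: pending_def)
    have q': "processed_at_comp B' \<le> ?q + (total_cap + ?C)"
      using queue_growth[OF h comp_in_nodes, of Processed] kC by (simp add: processed_at_comp_def)
    \<comment> \<open>The processed queue at the computation node grows by at most
      \<open>total_cap + C\<close>, as at most \<open>C\<close> pairs are combined. That growth
      costs only a multiple of the pending queries, and the old queue length is kept in the main
      term.\<close>
    have "2 * processed_at_comp B' * pending B' X' \<le> 2 * (?q + (total_cap + ?C)) * pending B' X'"
      using q' Z'0 by (intro mult_right_mono) simp_all
    also have "\<dots> = 2 * ?q * pending B' X' + 2 * (total_cap + ?C) * pending B' X'"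
      by (simp add: algebra_simps)
    also have "\<dots> \<le> 2 * ?q * pending B' X' + 2 * (total_cap + ?C) * (?Z + ?a)"
      using R0 nn by (intro add_left_mono mult_left_mono) (simp_all add: Z')
    also have "\<dots> = 2 * ?q * ?Z + 2 * ?q * (?a - ?k) + 2 * (total_cap + ?C) * ?Z + 2 * (total_cap + ?C) * ?a"
      by (simp add: Z' algebra_simps)
    finally have cross: "2 * processed_at_comp B' * pending B' X' \<le>
      2 * ?q * ?Z + 2 * ?q * (?a - ?k) + 2 * (total_cap + ?C) * ?Z + 2 * (total_cap + ?C) * ?a" .
    \<comment> \<open>Arrivals are integers, so the linear cost is absorbed by the quadratic
      one.\<close>
    have "?a \<le> ?a\<^sup>2" by (cases "card new") (auto simp: power2_eq_square)
    then have "2 * (total_cap + ?C) * ?a \<le> 2 * (total_cap + ?C) * ?a\<^sup>2"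
      using R0 by (intro mult_left_mono) simp_all
    moreover have "(3 * (?n * total_cap\<^sup>2) + 2 * (?n * ?C\<^sup>2)) + 2 * (total_cap + ?C) * ?a\<^sup>2 \<le> b * (1 + ?a\<^sup>2)"
      using bs R0 nn by (intro affine_le_square) (simp_all add: b_def b3_def)
    moreover have "2 * (total_cap + ?C) * ?Z \<le> b * ?Z"
      using bs nn R0 by (intro mult_right_mono) (simp_all add: b_def b3_def)
    moreover have "\<epsilon> * ?H \<le> e3 * ?H" using e nn by (intro mult_right_mono)
    \<comment> \<open>The number \<open>k\<close> of combined pairs cancels between the squared
      queues and the cross term, leaving the query arrivals as the input.\<close>
    moreover have "2 * (?k - lam) * ?q + 2 * ?q * (?a - ?k) = 2 * (?a - lam) * ?q"
      by (simp add: algebra_simps)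
    ultimately have 3: "processed_potential B' X' \<le> processed_potential B X + b * (1 + ?a\<^sup>2)
      + 2 * (?a - lam) * ?q + b * ?Z - \<epsilon> * ?H"
      unfolding processed_potential_def using V k2 cross by linarith
    show "drift_bound lam \<epsilon> b ?a B X B' X'"
      using 1 2 3 by (simp add: drift_bound_def)
  qed
qed

end

section \<open>Tags of past queries and the invariant along a sample path\<close>

definition past_tags :: "(nat \<Rightarrow> nat) \<Rightarrow> nat \<Rightarrow> tag set" where
  "past_tags A t = Sigma {..<t} (\<lambda>s. {..<A s})"

lemma card_past_tags: "card (past_tags A t) = (\<Sum>s<t. A s)"
  by (simp add: past_tags_def)

lemma past_tags_Suc: "past_tags A (Suc t) = past_tags A t \<union> new_tags t (A t)"
  by (auto simp: past_tags_def new_tags_def less_Suc_eq)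

lemma new_tags_fresh: "new_tags t n \<inter> past_tags A t = {}"
  by (auto simp: past_tags_def new_tags_def)

lemma new_tags_finite [simp]: "finite (new_tags t n)" "card (new_tags t n) = n"
  by (simp_all add: new_tags_def)

context split_network
begin

lemma consistent_path:
  assumes "\<forall>c. \<forall>k\<in>nodes N. B 0 c k = {}" "\<forall>c\<in>{Raw1, Raw2}. X 0 c = {}"
    and "\<forall>t. pi1_slot N (carried E1 E2) (new_tags t (A t)) (B t) (X t) (B (Suc t)) (X (Suc t))"
  shows "consistent (past_tags A t) (B t) (X t)"
proof (induction t)
  case 0
  show ?case using assms(1,2)
    by (simp add: consistent_def past_tags_def outstanding_def disjoint_family_on_def)
next
  case (Suc t)
  from assms(3) obtain cs mv K where
    "slot_by N (carried E1 E2) (new_tags t (A t)) (B t) (X t) (B (Suc t)) (X (Suc t)) cs mv K"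
    unfolding pi1_slot_iff by blast
  from consistent_step[OF Suc this _ new_tags_fresh] show ?case by (simp add: past_tags_Suc)
qed

end

subsection \<open>Expected drift and stability\<close>

text \<open>The extra 1 absorbs the initial value of a potential uniformly in
  \<open>T\<close>.\<close>

definition average_bounded :: "(nat \<Rightarrow> real) \<Rightarrow> bool" where
  "average_bounded x \<longleftrightarrow> (\<exists>c. \<forall>T. (\<Sum>t<T. x t) \<le> c * (real T + 1))"

lemma average_bounded_mono:
  assumes "average_bounded y" "\<And>t. x t \<le> y t"
  shows "average_bounded x"
  using assms unfolding average_bounded_def by (meson order_trans sum_mono)

text \<open>Telescoping the drift and dropping the non-negative final potential bounds the sum of
  \<open>g\<close>. A perturbation \<open>h\<close> is tolerated if it is itself bounded on average,
  which is what allows drift inequalities to be chained.\<close>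

lemma average_bounded_drift:
  fixes L :: "nat \<Rightarrow> real"
  assumes "\<epsilon> > 0" "d \<ge> 0" and L: "\<And>t. L t \<ge> 0" and H: "average_bounded h"
    and step: "\<And>t. L (Suc t) \<le> L t + b - \<epsilon> * g t + d * h t"
  shows "average_bounded g"
proof -
  obtain c where c: "\<And>T. (\<Sum>t<T. h t) \<le> c * (real T + 1)"
    using H by (auto simp: average_bounded_def)
  have tele: "L T + \<epsilon> * (\<Sum>t<T. g t) \<le> L 0 + b * real T + d * (\<Sum>t<T. h t)" for T
  proof (induction T)
    case (Suc T)
    with step[of T] show ?case by (simp add: algebra_simps)
  qed simp
  have "(\<Sum>t<T. g t) \<le> ((L 0 + \<bar>b\<bar> + d * c) / \<epsilon>) * (real T + 1)" for T
  proof -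
    have "\<epsilon> * (\<Sum>t<T. g t) \<le> L 0 + b * real T + d * (\<Sum>t<T. h t)"
      using tele[of T] L[of T] by linarith
    also have "\<dots> \<le> L 0 * (real T + 1) + \<bar>b\<bar> * (real T + 1) + d * (c * (real T + 1))"
    proof (intro add_mono mult_left_mono c \<open>d \<ge> 0\<close>)
      show "L 0 \<le> L 0 * (real T + 1)" using L[of 0] by (simp add: algebra_simps)
      show "b * real T \<le> \<bar>b\<bar> * (real T + 1)" by (intro mult_mono) auto
    qed
    finally have "\<epsilon> * (\<Sum>t<T. g t) \<le> (L 0 + \<bar>b\<bar> + d * c) * (real T + 1)"
      by (simp add: algebra_simps)
    then show ?thesis using \<open>\<epsilon> > 0\<close> by (simp add: field_simps)
  qed
  then show ?thesis unfolding average_bounded_def by blast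
qed

text \<open>The injection \<open>to_nat\<close> reduces the claim to sets of naturals and preserves
  \<open>card\<close>, including its value 0 on infinite sets.\<close>

lemma measurable_card_countable:
  fixes S :: "'a \<Rightarrow> 'b::countable set"
  assumes "\<And>q. {\<omega>\<in>space M. q \<in> S \<omega>} \<in> sets M"
  shows "(\<lambda>\<omega>. card (S \<omega>)) \<in> measurable M (count_space UNIV)"
proof -
  have "{\<omega>\<in>space M. i \<in> to_nat ` S \<omega>} \<in> sets M" for i
  proof (cases "i \<in> range (to_nat :: 'b \<Rightarrow> nat)")
    case True
    then obtain q :: 'b where q: "i = to_nat q" by blast
    have "i \<in> to_nat ` S \<omega> \<longleftrightarrow> q \<in> S \<omega>" for \<omega>
      unfolding q by (simp add: inj_image_mem_iff)
    then show ?thesis using assms by simp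
  next
    case False
    then have "{\<omega>\<in>space M. i \<in> to_nat ` S \<omega>} = {}" by blast
    then show ?thesis by (simp only: sets.empty_sets)
  qed
  then have "(\<lambda>\<omega>. card (to_nat ` S \<omega>)) \<in> measurable M (count_space UNIV)"
    by (rule measurable_card)
  then show ?thesis by (simp add: card_image)
qed

lemma strongly_stableI:
  assumes int: "\<And>t. integrable M (\<lambda>\<omega>. real (Q t \<omega>))"
    and avg: "average_bounded (\<lambda>t. \<integral>\<omega>. real (Q t \<omega>) \<partial>M)"
  shows "strongly_stable M Q"
proof -
  let ?e = "\<lambda>t. \<integral>\<omega>. real (Q t \<omega>) \<partial>M"
  obtain c where c: "\<And>T. (\<Sum>t<T. ?e t) \<le> c * (real T + 1)"
    using avg by (auto simp: average_bounded_def)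
  have e0: "?e t \<ge> 0" for t by simp
  have nn: "(\<integral>\<^sup>+\<omega>. of_nat (Q t \<omega>) \<partial>M) = ennreal (?e t)" for t
    using nn_integral_eq_integral[OF int[of t]] by (simp add: ennreal_of_nat_eq_real_of_nat)
  have "(\<Sum>t=1..T. \<integral>\<^sup>+\<omega>. of_nat (Q t \<omega>) \<partial>M) / of_nat T \<le> ennreal (3 * \<bar>c\<bar>)" if "T \<ge> 1" for T
  proof -
    \<comment> \<open>Slots 1 to \<open>T\<close> are among the first \<open>T + 1\<close>, counted
      from 0; the resulting factor \<open>T + 2\<close> is at most \<open>3 * T\<close> once
      \<open>T \<ge> 1\<close>.\<close>
    have "(\<Sum>t=1..T. ?e t) \<le> (\<Sum>t<Suc T. ?e t)"
      by (intro sum_mono2) (auto simp: e0)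
    also have "\<dots> \<le> c * (real (Suc T) + 1)" by (rule c)
    also have "\<dots> \<le> \<bar>c\<bar> * (3 * real T)" using that by (intro mult_mono) auto
    finally have "(\<Sum>t=1..T. ?e t) / real T \<le> 3 * \<bar>c\<bar>" using that by (simp add: field_simps)
    moreover have "(\<Sum>t=1..T. \<integral>\<^sup>+\<omega>. of_nat (Q t \<omega>) \<partial>M) / of_nat T = ennreal ((\<Sum>t=1..T. ?e t) / real T)"
    proof -
      have "(\<Sum>t=1..T. \<integral>\<^sup>+\<omega>. of_nat (Q t \<omega>) \<partial>M) = ennreal (\<Sum>t=1..T. ?e t)"
        unfolding nn by (rule sum_ennreal) (rule e0)
      moreover have "(of_nat T :: ennreal) = ennreal (real T)" by (rule ennreal_of_nat_eq_real_of_nat)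
      ultimately show ?thesis using that by (simp only:) (intro divide_ennreal sum_nonneg e0; simp)
    qed
    ultimately show ?thesis by (simp add: ennreal_leI)
  qed
  then have "eventually (\<lambda>T. (\<Sum>t=1..T. \<integral>\<^sup>+\<omega>. of_nat (Q t \<omega>) \<partial>M) / of_nat T \<le> ennreal (3 * \<bar>c\<bar>)) sequentially"
    by (intro eventually_sequentiallyI)
  then have "limsup (\<lambda>T. (\<Sum>t=1..T. \<integral>\<^sup>+\<omega>. of_nat (Q t \<omega>) \<partial>M) / of_nat T) \<le> ennreal (3 * \<bar>c\<bar>)"
    by (rule Limsup_bounded)
  also have "\<dots> < \<infinity>" by simp
  finally show ?thesis by (simp add: strongly_stable_def)
qed

lemma nat_le_square: "n \<le> n\<^sup>2" for n :: nat
  by (cases n) (auto simp: power2_eq_square)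

section \<open>The stochastic system: integrability, independence and expected drift\<close>

locale pi1_system = split_network N V1 V2 E1 E2 + prob_space M
  for N :: "'v network" and V1 V2 :: "'v set" and E1 E2 :: "'v set set" and M :: "'w measure" +
  fixes F :: "nat \<Rightarrow> 'w measure" and A :: "nat \<Rightarrow> 'w \<Rightarrow> nat"
    and B :: "nat \<Rightarrow> 'w \<Rightarrow> data_class \<Rightarrow> 'v \<Rightarrow> tag set"
    and X :: "nat \<Rightarrow> 'w \<Rightarrow> data_class \<Rightarrow> tag set"
    and lam :: real
  assumes iid: "iid_arrivals M A"
    and square_integrable: "integrable M (\<lambda>\<omega>. (real (A 0 \<omega>))\<^sup>2)"
    and mean: "integral\<^sup>L M (\<lambda>\<omega>. real (A 0 \<omega>)) = lam"
    and nonant: "nonanticipating M F N A B X"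
    and process: "pi1_process M N (carried E1 E2) A B X"
    and subcritical: "lam < lambda_star N"
begin

lemma arrivals_measurable [measurable]: "A t \<in> measurable M (count_space UNIV)"
  using iid by (simp add: iid_arrivals_def indep_vars_def)

lemma arrivals_transfer:
  fixes g :: "nat \<Rightarrow> real"
  shows "integrable M (\<lambda>\<omega>. g (A t \<omega>)) \<longleftrightarrow> integrable M (\<lambda>\<omega>. g (A 0 \<omega>))"
    and "(\<integral>\<omega>. g (A t \<omega>) \<partial>M) = (\<integral>\<omega>. g (A 0 \<omega>) \<partial>M)"
proof -
  have d: "distr M (count_space UNIV) (A t) = distr M (count_space UNIV) (A 0)"
    using iid by (simp add: iid_arrivals_def)
  show "integrable M (\<lambda>\<omega>. g (A t \<omega>)) \<longleftrightarrow> integrable M (\<lambda>\<omega>. g (A 0 \<omega>))"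
    using integrable_distr_eq[of "A t" M "count_space UNIV" g] integrable_distr_eq[of "A 0" M "count_space UNIV" g]
    by (simp add: d)
  show "(\<integral>\<omega>. g (A t \<omega>) \<partial>M) = (\<integral>\<omega>. g (A 0 \<omega>) \<partial>M)"
    using integral_distr[of "A t" M "count_space UNIV" g] integral_distr[of "A 0" M "count_space UNIV" g]
    by (simp add: d)
qed

lemma arrivals_square_integrable: "integrable M (\<lambda>\<omega>. (real (A t \<omega>))\<^sup>2)"
  using arrivals_transfer(1)[of "\<lambda>n. (real n)\<^sup>2" t] square_integrable by simp

lemma arrivals_integrable: "integrable M (\<lambda>\<omega>. real (A t \<omega>))"
  by (rule Bochner_Integration.integrable_bound[OF arrivals_square_integrable[of t]]) (auto simp: nat_le_square)

lemma arrivals_mean: "(\<integral>\<omega>. real (A t \<omega>) \<partial>M) = lam"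
  using arrivals_transfer(2)[of real t] mean by simp

lemma rate_nonneg: "0 \<le> lam"
  using mean by (simp add: integral_nonneg flip: mean)

text \<open>A dominating variable: each queue and the set of outstanding tags has at most
  \<open>arrived t\<close> elements. The potentials are at most quadratic, so its square
  integrability makes them integrable in every fixed slot.\<close>

definition arrived :: "nat \<Rightarrow> 'w \<Rightarrow> nat" where
  "arrived t \<omega> = (\<Sum>s<t. A s \<omega>)"

lemma arrived_square_integrable: "integrable M (\<lambda>\<omega>. (real (arrived t \<omega>))\<^sup>2)"
proof (induction t)
  case 0 then show ?case by (simp add: arrived_def)
next
  case (Suc t)
  have [measurable]: "arrived t \<in> measurable M (count_space UNIV)" for t
    unfolding arrived_def by measurable
  have bound: "(x + y)\<^sup>2 \<le> 2 * x\<^sup>2 + 2 * y\<^sup>2" for x y :: real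
    using sum_squares_bound[of x y] by (simp add: power2_sum)
  have "integrable M (\<lambda>\<omega>. 2 * (real (arrived t \<omega>))\<^sup>2 + 2 * (real (A t \<omega>))\<^sup>2)"
    using Suc arrivals_square_integrable by (intro Bochner_Integration.integrable_add integrable_mult_right) auto
  then show ?case
    by (rule Bochner_Integration.integrable_bound) (auto simp: arrived_def bound intro!: order_trans[OF _ abs_ge_self])
qed

lemma consistent: "\<omega> \<in> space M \<Longrightarrow> consistent (past_tags (\<lambda>s. A s \<omega>) t) (B t \<omega>) (X t \<omega>)"
  using process unfolding pi1_process_def
  by (intro consistent_path[where B = "\<lambda>t. B t \<omega>" and X = "\<lambda>t. X t \<omega>" and A = "\<lambda>s. A s \<omega>"]) blast+

lemma queue_le_arrived: "\<omega> \<in> space M \<Longrightarrow> k \<in> nodes N \<Longrightarrow> card (B t \<omega> c k) \<le> arrived t \<omega>"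
  and outstanding_le_arrived: "\<omega> \<in> space M \<Longrightarrow> card (outstanding (B t \<omega>) (X t \<omega>) Raw1) \<le> arrived t \<omega>"
  using card_mono[OF _ tags_subset(1)[OF consistent]] card_mono[OF _ outstanding_subset[OF consistent]]
    consistent[of \<omega> t]
  by (auto simp: consistent_def card_past_tags arrived_def)

lemma sub: "subalgebra M (F t)"
  using nonant by (simp add: nonanticipating_def)

lemma space_history: "space (F t) = space M"
  using sub by (simp add: subalgebra_def)

lemma queue_event: "k \<in> nodes N \<Longrightarrow> {\<omega>\<in>space (F t). q \<in> B t \<omega> c k} \<in> sets (F t)"
  using nonant unfolding nonanticipating_def space_history by blast

lemma buffer_event: "c \<in> {Raw1, Raw2} \<Longrightarrow> {\<omega>\<in>space (F t). q \<in> X t \<omega> c} \<in> sets (F t)"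
  using nonant unfolding nonanticipating_def space_history by blast

lemma queue_measurable:
  assumes "k \<in> nodes N"
  shows "(\<lambda>\<omega>. card (B t \<omega> c k)) \<in> measurable (F t) (count_space UNIV)"
  by (intro measurable_card_countable queue_event assms)

lemma outstanding_measurable:
  "(\<lambda>\<omega>. card (outstanding (B t \<omega>) (X t \<omega>) Raw1)) \<in> measurable (F t) (count_space UNIV)"
proof (rule measurable_card_countable)
  fix q
  have "{\<omega>\<in>space (F t). q \<in> outstanding (B t \<omega>) (X t \<omega>) Raw1} =
    {\<omega>\<in>space (F t). q \<in> X t \<omega> Raw1} \<union> (\<Union>k\<in>nodes N. {\<omega>\<in>space (F t). q \<in> B t \<omega> Raw1 k})"
    by (auto simp: outstanding_def)
  also have "\<dots> \<in> sets (F t)"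
    by (intro sets.Un sets.finite_UN queue_event buffer_event) simp_all
  finally show "{\<omega>\<in>space (F t). q \<in> outstanding (B t \<omega>) (X t \<omega>) Raw1} \<in> sets (F t)" .
qed

lemma buffer_measurable:
  assumes "c \<in> {Raw1, Raw2}"
  shows "(\<lambda>\<omega>. card (X t \<omega> c)) \<in> measurable (F t) (count_space UNIV)"
  by (intro measurable_card_countable buffer_event assms)

lemma history_measurable: "f \<in> measurable (F t) K \<Longrightarrow> f \<in> measurable M K"
  using measurable_from_subalg[OF sub] .

text \<open>Independence passes to smaller sigma-algebras: the one generated by \<open>f\<close>
  lies in the history, and the one generated by the real-valued arrivals lies in the one generated
  by \<open>A t\<close>.\<close>

lemma independent_of_history:
  fixes f :: "'w \<Rightarrow> real"
  assumes f: "f \<in> borel_measurable (F t)"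
  shows "indep_var borel f borel (\<lambda>\<omega>. real (A t \<omega>))"
  unfolding indep_var_eq
proof (intro conjI)
  have "indep_set (sets (F t)) (sets (vimage_algebra (space M) (A t) (count_space UNIV)))"
    using nonant by (simp add: nonanticipating_def)
  moreover have "sigma_sets (space M) {f -` C \<inter> space M |C. C \<in> sets borel} \<subseteq> sets (F t)"
  proof -
    have "{f -` C \<inter> space M |C. C \<in> sets borel} \<subseteq> sets (F t)"
      using measurable_sets[OF f] by (auto simp: space_history)
    then show ?thesis using sets.sigma_sets_subset[of _ "F t"] by (simp add: space_history)
  qed
  moreover have "sigma_sets (space M) {(\<lambda>\<omega>. real (A t \<omega>)) -` C \<inter> space M |C. C \<in> sets borel}
      \<subseteq> sets (vimage_algebra (space M) (A t) (count_space UNIV))"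
  proof -
    let ?V = "vimage_algebra (space M) (A t) (count_space UNIV)"
    have "(\<lambda>\<omega>. real (A t \<omega>)) -` C \<inter> space M \<in> sets ?V" for C :: "real set"
    proof -
      have "(\<lambda>\<omega>. real (A t \<omega>)) -` C \<inter> space M = A t -` (real -` C) \<inter> space M" by auto
      also have "\<dots> \<in> sets ?V" by (rule in_vimage_algebra) simp
      finally show ?thesis .
    qed
    then have "{(\<lambda>\<omega>. real (A t \<omega>)) -` C \<inter> space M |C. C \<in> sets borel} \<subseteq> sets ?V" by blast
    then show ?thesis using sets.sigma_sets_subset[of _ ?V] by simp
  qed
  ultimately show "indep_set (sigma_sets (space M) {f -` C \<inter> space M |C. C \<in> sets borel})
     (sigma_sets (space M) {(\<lambda>\<omega>. real (A t \<omega>)) -` C \<inter> space M |C. C \<in> sets borel})"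
    unfolding indep_set_def by (elim indep_sets_mono_sets) (auto split: bool.split)
qed (use history_measurable[OF f] in \<open>auto\<close>)

lemma dominated_integrable:
  fixes f :: "'w \<Rightarrow> real"
  assumes "f \<in> borel_measurable (F t)" "\<And>\<omega>. \<omega> \<in> space M \<Longrightarrow> \<bar>f \<omega>\<bar> \<le> (real (arrived t \<omega>))\<^sup>2"
  shows "integrable M f"
  by (rule Bochner_Integration.integrable_bound[OF arrived_square_integrable[of t] history_measurable[OF assms(1)]])
    (use assms(2) in auto)

text \<open>The weight \<open>S t\<close> depends on the history only and \<open>A t\<close> is
  independent of it with mean \<open>lam\<close>, so the term with \<open>A t - lam\<close> vanishes
  in expectation. What remains is a drift inequality between real sequences.\<close>

lemma drift_average:
  fixes L S g h :: "nat \<Rightarrow> 'w \<Rightarrow> real"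
  assumes e: "\<epsilon> > 0" "b \<ge> 0" "d \<ge> 0"
    and int: "\<And>t. integrable M (L t)" "\<And>t. integrable M (S t)" "\<And>t. integrable M (g t)" "\<And>t. integrable M (h t)"
    and S: "\<And>t. S t \<in> borel_measurable (F t)" and L: "\<And>t \<omega>. L t \<omega> \<ge> 0"
    and avg: "average_bounded (\<lambda>t. expectation (h t))"
    and step: "\<And>t \<omega>. \<omega> \<in> space M \<Longrightarrow> L (Suc t) \<omega> \<le> L t \<omega> + b * (1 + (real (A t \<omega>))\<^sup>2)
      + 2 * (real (A t \<omega>) - lam) * S t \<omega> + d * h t \<omega> - \<epsilon> * g t \<omega>"
  shows "average_bounded (\<lambda>t. expectation (g t))"
proof (rule average_bounded_drift[OF e(1,3) _ avg])
  show "expectation (L t) \<ge> 0" for t by (simp add: L)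
  fix t
  have ind: "indep_var borel (S t) borel (\<lambda>\<omega>. real (A t \<omega>))"
    by (rule independent_of_history[OF S])
  note AS = indep_var_integrable[OF ind int(2) arrivals_integrable]
    and EAS = indep_var_lebesgue_integral[OF ind int(2) arrivals_integrable]
  have "expectation (L (Suc t)) \<le> expectation (\<lambda>\<omega>. L t \<omega> + b * (1 + (real (A t \<omega>))\<^sup>2)
      + 2 * (S t \<omega> * real (A t \<omega>) - lam * S t \<omega>) + d * h t \<omega> - \<epsilon> * g t \<omega>)"
    using step by (intro integral_mono) (auto simp: int AS arrivals_square_integrable algebra_simps)
  also have "\<dots> = expectation (L t) + b * (1 + expectation (\<lambda>\<omega>. (real (A t \<omega>))\<^sup>2))
      + 2 * (expectation (S t) * lam - lam * expectation (S t)) + d * expectation (h t) - \<epsilon> * expectation (g t)"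
    by (simp add: int AS arrivals_square_integrable EAS arrivals_mean prob_space)
  also have "expectation (\<lambda>\<omega>. (real (A t \<omega>))\<^sup>2) = expectation (\<lambda>\<omega>. (real (A 0 \<omega>))\<^sup>2)"
    using arrivals_transfer(2)[of "\<lambda>n. (real n)\<^sup>2" t] by simp
  finally show "expectation (L (Suc t)) \<le> expectation (L t) + b * (1 + expectation (\<lambda>\<omega>. (real (A 0 \<omega>))\<^sup>2))
      - \<epsilon> * expectation (g t) + d * expectation (h t)" by simp
qed

lemma card_integrable:
  assumes "k \<in> nodes N"
  shows "integrable M (\<lambda>\<omega>. real (card (B t \<omega> c k)))"
    and "integrable M (\<lambda>\<omega>. (real (card (B t \<omega> c k)))\<^sup>2)"
    and "integrable M (\<lambda>\<omega>. real (card (B t \<omega> c k)) * pending (B t \<omega>) (X t \<omega>))"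
proof -
  note [measurable] = queue_measurable[OF assms] outstanding_measurable
  note q = queue_le_arrived[OF _ assms] and z = outstanding_le_arrived
  show "integrable M (\<lambda>\<omega>. real (card (B t \<omega> c k)))"
    by (rule dominated_integrable[of _ t], measurable)
      (use q in \<open>auto intro: order_trans[OF _ nat_le_square]\<close>)
  show "integrable M (\<lambda>\<omega>. (real (card (B t \<omega> c k)))\<^sup>2)"
    by (rule dominated_integrable[of _ t], measurable)
      (use q in \<open>auto intro!: power_mono\<close>)
  show "integrable M (\<lambda>\<omega>. real (card (B t \<omega> c k)) * pending (B t \<omega>) (X t \<omega>))"
    unfolding pending_def
    by (rule dominated_integrable[of _ t], measurable)
      (use q z in \<open>auto simp: power2_eq_square abs_mult intro!: mult_mono\<close>)
qed

lemma pending_integrable: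
  "integrable M (\<lambda>\<omega>. pending (B t \<omega>) (X t \<omega>))"
  "integrable M (\<lambda>\<omega>. (pending (B t \<omega>) (X t \<omega>))\<^sup>2)"
proof -
  note [measurable] = outstanding_measurable
  note z = outstanding_le_arrived
  show "integrable M (\<lambda>\<omega>. pending (B t \<omega>) (X t \<omega>))"
    unfolding pending_def by (rule dominated_integrable[of _ t], measurable)
      (use z in \<open>auto intro: order_trans[OF _ nat_le_square]\<close>)
  show "integrable M (\<lambda>\<omega>. (pending (B t \<omega>) (X t \<omega>))\<^sup>2)"
    unfolding pending_def by (rule dominated_integrable[of _ t], measurable)
      (use z in \<open>auto intro!: power_mono\<close>)
qed

lemma averages_bounded:
  "average_bounded (\<lambda>t. expectation (\<lambda>\<omega>. backlog {Raw1, Raw2} (B t \<omega>)))"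
  "average_bounded (\<lambda>t. expectation (\<lambda>\<omega>. pending (B t \<omega>) (X t \<omega>)))"
  "average_bounded (\<lambda>t. expectation (\<lambda>\<omega>. backlog {Processed} (B t \<omega>)))"
proof -
  obtain \<epsilon> b where e: "\<epsilon> > 0" "b \<ge> 0" and drift: "\<And>T new B X B' X' cs mv K.
    consistent T B X \<Longrightarrow> slot_by N (carried E1 E2) new B X B' X' cs mv K \<Longrightarrow> finite new \<Longrightarrow> new \<inter> T = {} \<Longrightarrow>
    drift_bound lam \<epsilon> b (real (card new)) B X B' X'"
    using slot_drift[OF subcritical rate_nonneg] by blast
  have path: "backlog_sq {Raw1, Raw2} (B (Suc t) \<omega>) \<le> backlog_sq {Raw1, Raw2} (B t \<omega>) + b * (1 + (real (A t \<omega>))\<^sup>2)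
      + 2 * (real (A t \<omega>) - lam) * raw_at_sources (B t \<omega>) - \<epsilon> * backlog {Raw1, Raw2} (B t \<omega>)"
    "(pending (B (Suc t) \<omega>) (X (Suc t) \<omega>))\<^sup>2 \<le> (pending (B t \<omega>) (X t \<omega>))\<^sup>2 + b * (1 + (real (A t \<omega>))\<^sup>2)
      + 2 * (real (A t \<omega>) - lam) * pending (B t \<omega>) (X t \<omega>) + b * backlog {Raw1, Raw2} (B t \<omega>)
      - \<epsilon> * pending (B t \<omega>) (X t \<omega>)"
    "processed_potential (B (Suc t) \<omega>) (X (Suc t) \<omega>) \<le> processed_potential (B t \<omega>) (X t \<omega>)
      + b * (1 + (real (A t \<omega>))\<^sup>2) + 2 * (real (A t \<omega>) - lam) * processed_at_comp (B t \<omega>)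
      + b * pending (B t \<omega>) (X t \<omega>) - \<epsilon> * backlog {Processed} (B t \<omega>)"
    if w: "\<omega> \<in> space M" for t \<omega>
  proof -
    from w process obtain cs mv K where slot: "slot_by N (carried E1 E2) (new_tags t (A t \<omega>))
        (B t \<omega>) (X t \<omega>) (B (Suc t) \<omega>) (X (Suc t) \<omega>) cs mv K"
      unfolding pi1_process_def pi1_slot_iff by blast
    note d = drift[OF consistent[OF w] slot new_tags_finite(1) new_tags_fresh,
        unfolded new_tags_finite(2) drift_bound_def]
    from d show "backlog_sq {Raw1, Raw2} (B (Suc t) \<omega>) \<le> backlog_sq {Raw1, Raw2} (B t \<omega>) + b * (1 + (real (A t \<omega>))\<^sup>2)
      + 2 * (real (A t \<omega>) - lam) * raw_at_sources (B t \<omega>) - \<epsilon> * backlog {Raw1, Raw2} (B t \<omega>)"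
    "(pending (B (Suc t) \<omega>) (X (Suc t) \<omega>))\<^sup>2 \<le> (pending (B t \<omega>) (X t \<omega>))\<^sup>2 + b * (1 + (real (A t \<omega>))\<^sup>2)
      + 2 * (real (A t \<omega>) - lam) * pending (B t \<omega>) (X t \<omega>) + b * backlog {Raw1, Raw2} (B t \<omega>)
      - \<epsilon> * pending (B t \<omega>) (X t \<omega>)"
    "processed_potential (B (Suc t) \<omega>) (X (Suc t) \<omega>) \<le> processed_potential (B t \<omega>) (X t \<omega>)
      + b * (1 + (real (A t \<omega>))\<^sup>2) + 2 * (real (A t \<omega>) - lam) * processed_at_comp (B t \<omega>)
      + b * pending (B t \<omega>) (X t \<omega>) - \<epsilon> * backlog {Processed} (B t \<omega>)"
      by blast+
  qed
  note int = card_integrable pending_integrable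
  have G: "integrable M (\<lambda>\<omega>. backlog Cs (B t \<omega>))" "integrable M (\<lambda>\<omega>. backlog_sq Cs (B t \<omega>))" for Cs t
    unfolding backlog_def backlog_sq_def by (intro Bochner_Integration.integrable_sum int; simp)+
  have H: "integrable M (\<lambda>\<omega>. raw_at_sources (B t \<omega>))" "integrable M (\<lambda>\<omega>. processed_at_comp (B t \<omega>))"
    "integrable M (\<lambda>\<omega>. processed_potential (B t \<omega>) (X t \<omega>))" for t
  proof -
    show "integrable M (\<lambda>\<omega>. raw_at_sources (B t \<omega>))" unfolding raw_at_sources_def
      by (intro Bochner_Integration.integrable_sum int end_points_in_nodes)
    show "integrable M (\<lambda>\<omega>. processed_at_comp (B t \<omega>))" unfolding processed_at_comp_def
      by (intro int comp_in_nodes)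
    show "integrable M (\<lambda>\<omega>. processed_potential (B t \<omega>) (X t \<omega>))"
      unfolding processed_potential_def processed_at_comp_def mult.assoc
      by (intro Bochner_Integration.integrable_add integrable_mult_right int comp_in_nodes G)
  qed
  have meas: "(\<lambda>\<omega>. raw_at_sources (B t \<omega>)) \<in> borel_measurable (F t)"
    "(\<lambda>\<omega>. processed_at_comp (B t \<omega>)) \<in> borel_measurable (F t)"
    "(\<lambda>\<omega>. pending (B t \<omega>) (X t \<omega>)) \<in> borel_measurable (F t)" for t
  proof -
    note [measurable] = queue_measurable[OF end_points_in_nodes(1)] queue_measurable[OF comp_in_nodes]
      outstanding_measurable
    show "(\<lambda>\<omega>. raw_at_sources (B t \<omega>)) \<in> borel_measurable (F t)"
      "(\<lambda>\<omega>. processed_at_comp (B t \<omega>)) \<in> borel_measurable (F t)"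
      "(\<lambda>\<omega>. pending (B t \<omega>) (X t \<omega>)) \<in> borel_measurable (F t)"
      unfolding raw_at_sources_def processed_at_comp_def pending_def by measurable
  qed
  have sq: "backlog_sq Cs (B t \<omega>) \<ge> 0" for Cs t \<omega>
    unfolding backlog_sq_def by (intro sum_nonneg) simp
  show raw: "average_bounded (\<lambda>t. expectation (\<lambda>\<omega>. backlog {Raw1, Raw2} (B t \<omega>)))"
    \<comment> \<open>The cascade starts without perturbation: \<open>order_refl\<close> sets
      \<open>d\<close> to 0, and \<open>h\<close> is the zero process.\<close>
    by (rule drift_average[OF e(1,2) order_refl G(2) H(1) G(1) _ meas(1) sq, where h = "\<lambda>_ _. 0"])
      (use path(1) in \<open>auto simp: average_bounded_def intro: exI[of _ 0]\<close>)
  show pend: "average_bounded (\<lambda>t. expectation (\<lambda>\<omega>. pending (B t \<omega>) (X t \<omega>)))"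
    \<comment> \<open>Here the perturbation is the raw backlog just bounded; below, the pending
      queries take that place in the bound for the processed queues.\<close>
    by (rule drift_average[OF e(1,2,2) int(5) int(4) int(4) G(1) meas(3) _ raw path(2)]) simp_all
  show "average_bounded (\<lambda>t. expectation (\<lambda>\<omega>. backlog {Processed} (B t \<omega>)))"
    by (rule drift_average[OF e(1,2,2) H(3) H(2) G(1) int(4) meas(2) _ pend path(3)])
      (simp_all add: processed_potential_def sq processed_at_comp_def pending_def)
qed

lemma queue_le_backlog:
  assumes "k \<in> nodes N" "c \<in> Cs"
  shows "real (card (B t \<omega> c k)) \<le> backlog Cs (B t \<omega>)"
proof -
  have "real (card (B t \<omega> c k)) \<le> (\<Sum>k\<in>nodes N. real (card (B t \<omega> c k)))"
    using assms by (intro member_le_sum) auto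
  also have "\<dots> \<le> backlog Cs (B t \<omega>)" unfolding backlog_def
    using assms by (intro member_le_sum[where f = "\<lambda>c. \<Sum>k\<in>nodes N. real (card (B t \<omega> c k))"]) (auto intro: sum_nonneg finite)
  finally show ?thesis .
qed

lemma stable: "system_stable M N B X"
  unfolding system_stable_def
proof (intro conjI allI ballI)
  fix c k assume k: "k \<in> nodes N"
  let ?Cs = "if c = Processed then {Processed} else {Raw1, Raw2}"
  have c: "c \<in> ?Cs" by (cases c) auto
  have int: "integrable M (\<lambda>\<omega>. backlog ?Cs (B t \<omega>))" for t
    unfolding backlog_def by (intro Bochner_Integration.integrable_sum card_integrable)
  have "average_bounded (\<lambda>t. expectation (\<lambda>\<omega>. backlog ?Cs (B t \<omega>)))"
    using averages_bounded by simp
  then have "average_bounded (\<lambda>t. expectation (\<lambda>\<omega>. real (card (B t \<omega> c k))))"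
    by (rule average_bounded_mono) (intro integral_mono int card_integrable k queue_le_backlog c)
  then show "strongly_stable M (\<lambda>t \<omega>. card (B t \<omega> c k))"
    by (intro strongly_stableI card_integrable k)
next
  fix c assume c: "c \<in> {Raw1, Raw2}"
  \<comment> \<open>Since both raw classes have the same outstanding tags, the pending count defined
    through \<open>Raw1\<close> bounds the buffer of \<open>Raw2\<close> as well.\<close>
  have le: "card (X t \<omega> c) \<le> card (outstanding (B t \<omega>) (X t \<omega>) Raw1)" if w: "\<omega> \<in> space M" for t \<omega>
  proof (rule card_mono)
    show "finite (outstanding (B t \<omega>) (X t \<omega>) Raw1)"
      by (rule finite_outstanding[OF consistent[OF w]]) simp
    show "X t \<omega> c \<subseteq> outstanding (B t \<omega>) (X t \<omega>) Raw1"
      using c consistent[OF w, of t] by (auto simp: consistent_def outstanding_def)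
  qed
  note [measurable] = buffer_measurable[OF c]
  have int: "integrable M (\<lambda>\<omega>. real (card (X t \<omega> c)))" for t
  proof (rule dominated_integrable[of _ t], measurable)
    fix \<omega> assume w: "\<omega> \<in> space M"
    have "card (X t \<omega> c) \<le> (arrived t \<omega>)\<^sup>2"
      using le[OF w, of t] outstanding_le_arrived[OF w, of t] nat_le_square[of "arrived t \<omega>"] by linarith
    then have "real (card (X t \<omega> c)) \<le> real ((arrived t \<omega>)\<^sup>2)" by (rule of_nat_mono)
    then show "\<bar>real (card (X t \<omega> c))\<bar> \<le> (real (arrived t \<omega>))\<^sup>2" by simp
  qed
  have "average_bounded (\<lambda>t. expectation (\<lambda>\<omega>. real (card (X t \<omega> c))))"
    by (rule average_bounded_mono[OF averages_bounded(2)])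
      (intro integral_mono int pending_integrable, simp add: pending_def le)
  with int show "strongly_stable M (\<lambda>t \<omega>. card (X t \<omega> c))" by (rule strongly_stableI)
qed

end

theorem theorem2:
  fixes N :: "'v network" and V1 V2 :: "'v set" and E1 E2 :: "'v set set"
    and M :: "'w measure" and F :: "nat \<Rightarrow> 'w measure" and A :: "nat \<Rightarrow> 'w \<Rightarrow> nat"
    and B :: "nat \<Rightarrow> 'w \<Rightarrow> data_class \<Rightarrow> 'v \<Rightarrow> tag set"
    and X :: "nat \<Rightarrow> 'w \<Rightarrow> data_class \<Rightarrow> tag set"
    and lam :: real
  assumes "wf_network N"
    and "non_overlapping N V1 E1 V2 E2"
    and "prob_space M"
    and "iid_arrivals M A"
    and "integrable M (\<lambda>\<omega>. (real (A 0 \<omega>))\<^sup>2)"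
    and "integral\<^sup>L M (\<lambda>\<omega>. real (A 0 \<omega>)) = lam"
    and "nonanticipating M F N A B X"
    and "pi1_process M N (carried E1 E2) A B X"
    and "lam < lambda_star N"
  shows "system_stable M N B X"
proof -
  interpret prob_space M by (rule assms(3))
  interpret pi1_system N V1 V2 E1 E2 M F A B X lam
    by unfold_locales (use assms in simp_all)
  show ?thesis by (rule stable)
qed

end
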